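(* Let $G=(V,E)$ be a simple undirected graph with finite or countably infinite vertex set $V$, and let $\delta\in[0,1]$. Let $\{X_v:v\in V\}$ be i.i.d. $\mathrm{Bern}(1/2)$, let $\{Z_e:e\in E\}$ be i.i.d. $\mathrm{Bern}(\delta)$ and independent of $X_V$, and for each edge $e=(u,v)\in E$ let $Y_e=X_u\oplus X_v\oplus Z_e$ (addition mod 2). Then for every subset $S\subset V$ and every vertex $v\in V$, $$I(X_v;X_S,Y_E)\le \mathrm{perc}_G(v,S)\,\log 2,$$ where $\mathrm{perc}_G(v,S)$ is the probability that $v$ is connected to some vertex of $S$ in the random subgraph $\mathrm{ER}(G,\eta)$ with $\eta=(1-2\delta)^2$ (in particular $\mathrm{perc}_G(v,S)=1$ if $v\in S$).
   Context: $X_S=\{X_v:v\in S\}$, $Y_E=\{Y_e:e\in E\}$. $I(\cdot;\cdot)$ denotes mutual information, with logarithms in an arbitrary fixed base. $\mathrm{ER}(G,p)$ denotes the random subgraph of $G$ on vertex set $V$ in which each edge of $E$ is retained independently with probability $p$. *)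

theory Defs
  imports "HOL-Probability.Probability"
begin

definition simple_graph :: "'v set \<Rightarrow> 'v set set \<Rightarrow> bool" where
  "simple_graph V E \<longleftrightarrow> E \<subseteq> {{u, w} | u w. u \<in> V \<and> w \<in> V \<and> u \<noteq> w}"

text \<open>The random subgraph ER(G,p): each edge of E retained independently with probability p.
  A sample is the indicator function of the retained edges.\<close>
definition ER :: "'v set set \<Rightarrow> real \<Rightarrow> ('v set \<Rightarrow> bool) measure" where
  "ER E p = PiM E (\<lambda>_. measure_pmf (bernoulli_pmf p))"

definition open_adj :: "'v set set \<Rightarrow> ('v set \<Rightarrow> bool) \<Rightarrow> ('v \<times> 'v) set" where
  "open_adj E \<omega> = {(a, c). {a, c} \<in> E \<and> \<omega> {a, c}}"

definition perc :: "'v set set \<Rightarrow> real \<Rightarrow> 'v \<Rightarrow> 'v set \<Rightarrow> real" where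
  "perc E p v S = measure (ER E p)
     {\<omega> \<in> space (ER E p). \<exists>u\<in>S. (v, u) \<in> (open_adj E \<omega>)\<^sup>*}"

end

theory Submission
  imports Defs "HOL-Real_Asymp.Real_Asymp"
begin

text \<open>
  Write \<open>\<sigma>\<close> for the spins \<open>(- 1) ^ X\<close>, \<open>W = (X_S, Y_E)\<close>, \<open>\<theta> = 1 - 2 \<delta>\<close>, \<open>\<eta> = \<theta>\<^sup>2\<close> and
  \<open>m = \<E>[\<sigma>_v | W]\<close>.  The elementary bound of the binary divergence by its quadratic counterpart
  gives \<open>I(X_v; W) \<le> \<E>[m\<^sup>2] log 2\<close>, so it suffices to prove the stronger statement
  \<open>\<E>[m\<^sup>2] \<le> perc\<close>, or by duality \<open>(\<E>[\<sigma>_v g(W)])\<^sup>2 \<le> perc \<cdot> \<E>[g(W)\<^sup>2]\<close> for \<open>g\<close> depending on finitely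
  many coordinates.  For such \<open>g\<close>, and for a set \<open>A\<close> of open edges, let \<open>h_A(x)\<close> be obtained by
  averaging \<open>g\<close> over the observations of closed edges and by replacing, on an open edge \<open>e\<close>, the
  observation by its true parity \<open>T_e\<close> with kernel \<open>(1 + y T_e / \<theta>) / 2\<close>.  If \<open>A\<close> is a sample of \<open>ER(G, \<eta>)\<close>,
  then the first and second moments of \<open>h_A\<close> given \<open>x\<close> are those of \<open>g(W)\<close>, whereas
  \<open>\<E>[\<sigma>_v h_A] = 0\<close> unless \<open>A\<close> connects \<open>v\<close> to \<open>S\<close>; Cauchy-Schwarz finishes the proof.
\<close>

section \<open>The correlation bound on a finite graph\<close>

text \<open>A 0/1 configuration is encoded as the set of indices carrying a 1, so the same sign
  serves both the vertex bits and the edge observations.\<close>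

definition spin :: "'a set \<Rightarrow> 'a \<Rightarrow> real" where
  "spin x a = (if a \<in> x then - 1 else 1)"

text \<open>This is \<open>T_e\<close>, the product of the spins at the two ends of an edge
  \<open>e\<close>, which the observation of \<open>e\<close> would show in the absence of
  noise.\<close>

definition edge_parity :: "'v set \<Rightarrow> 'v set \<Rightarrow> real" where
  "edge_parity x e = (- 1) ^ card (e \<inter> x)"

lemma spin_square [simp]: "spin x a * spin x a = 1"
  by (simp add: spin_def)

lemma edge_parity_square [simp]: "edge_parity x e * edge_parity x e = 1"
  by (simp add: edge_parity_def flip: power_add mult_2)

text \<open>Distributivity, with \<open>a e\<close> or \<open>b e\<close> chosen separately for each
  edge. Averages over the random open set \<open>A\<close> thereby reduce to a calculation on a
  single edge.\<close>

lemma sum_Pow_prod_if: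
  fixes a b :: "'e \<Rightarrow> 'r::comm_ring_1"
  assumes "finite F"
  shows "(\<Sum>A\<in>Pow F. \<Prod>e\<in>F. if e \<in> A then a e else b e) = (\<Prod>e\<in>F. a e + b e)"
proof -
  have "(\<Prod>e\<in>F. if e \<in> A then a e else b e) = prod a A * prod b (F - A)" if "A \<in> Pow F" for A
  proof -
    have "(\<Prod>e\<in>F. if e \<in> A then a e else b e) = prod a (F \<inter> A) * prod b (F \<inter> - A)"
      using assms by (subst prod.If_cases) (auto simp: Collect_mem_eq)
    also have "F \<inter> A = A" using that by auto
    also have "F \<inter> - A = F - A" by auto
    finally show ?thesis .
  qed
  then show ?thesis using prod_add[OF assms, of a b] by simp
qed

text \<open>An edge inside \<open>C\<close> has both endpoint spins flipped and the two signs
  cancel; an edge disjoint from \<open>C\<close> is untouched.\<close>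

lemma edge_parity_sym_diff:
  assumes "card e = 2" and "e \<subseteq> C \<or> e \<inter> C = {}"
  shows "edge_parity (sym_diff x C) e = edge_parity x e"
  using assms(2)
proof
  assume "e \<subseteq> C"
  have fin: "finite e" using assms(1) card.infinite by force
  have "e \<inter> sym_diff x C = e - e \<inter> x" using \<open>e \<subseteq> C\<close> by auto
  then have "card (e \<inter> sym_diff x C) + card (e \<inter> x) = 2"
    using card_Diff_subset[of "e \<inter> x" e] card_mono[of e "e \<inter> x"] fin assms(1) by auto
  then have "(-1::real) ^ card (e \<inter> sym_diff x C) * (- 1) ^ card (e \<inter> x) = 1"
    by (simp flip: power_add)
  then show ?thesis unfolding edge_parity_def
    by (metis mult.right_neutral mult_minus1_right mult_cancel_right neg_one_even_power neg_one_odd_power minus_minus)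
next
  assume "e \<inter> C = {}"
  then have "e \<inter> sym_diff x C = e \<inter> x" by auto
  then show ?thesis by (simp add: edge_parity_def)
qed

definition connects :: "'v set set \<Rightarrow> 'v set set \<Rightarrow> 'v \<Rightarrow> 'v set \<Rightarrow> bool" where
  "connects F A v S \<longleftrightarrow> (\<exists>u\<in>S. (v, u) \<in> (open_adj F (\<lambda>e. e \<in> A))\<^sup>*)"

text \<open>Flipping the open cluster of \<open>v\<close> is an involution that negates the spin of \<open>v\<close> and
  preserves everything \<open>H\<close> depends on.\<close>
lemma sum_spin_eq_0_if_not_connects:
  fixes H :: "'v set \<Rightarrow> real"
  assumes "finite U" and "v \<in> U" and A: "A \<subseteq> F" and edges: "\<And>e. e \<in> F \<Longrightarrow> e \<subseteq> U \<and> card e = 2"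
    and "\<not> connects F A v S"
    and H: "\<And>x x'. x \<inter> S = x' \<inter> S \<Longrightarrow> (\<And>e. e \<in> A \<Longrightarrow> edge_parity x e = edge_parity x' e) \<Longrightarrow> H x = H x'"
  shows "(\<Sum>x\<in>Pow U. spin x v * H x) = 0"
proof -
  define R where "R = open_adj F (\<lambda>e. e \<in> A)"
  define C where "C = {u. (v, u) \<in> R\<^sup>*}"
  have "v \<in> C" by (simp add: C_def)
  have CU: "C \<subseteq> U"
  proof
    fix u assume "u \<in> C"
    then have "(v, u) \<in> R\<^sup>*" by (simp add: C_def)
    then show "u \<in> U"
      by (induction) (use \<open>v \<in> U\<close> edges in \<open>auto simp: R_def open_adj_def\<close>)
  qed
  have CS: "C \<inter> S = {}"
    using assms(5) by (auto simp: connects_def C_def R_def)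
  \<comment> \<open>The relation \<open>R\<close> is symmetric, so an open edge with one end in the
    cluster of \<open>v\<close> has both ends there.\<close>
  have cluster: "e \<subseteq> C \<or> e \<inter> C = {}" if "e \<in> A" for e
  proof -
    from that A edges obtain a c where e: "e = {a, c}" by (meson card_2_iff subsetD)
    have "(a, c) \<in> R" "(c, a) \<in> R" using that A
      by (auto simp: R_def open_adj_def e insert_commute)
    then have "a \<in> C \<longleftrightarrow> c \<in> C" unfolding C_def
      by (blast intro: rtrancl_into_rtrancl)
    then show ?thesis by (auto simp: e)
  qed
  have "(\<Sum>x\<in>Pow U. spin x v * H x) = (\<Sum>x\<in>Pow U. spin (sym_diff x C) v * H (sym_diff x C))"
    by (rule sum.reindex_bij_witness[of _ "\<lambda>x. sym_diff x C" "\<lambda>x. sym_diff x C"])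
       (use CU in \<open>auto simp: Un_Diff Diff_Un double_diff intro!: arg_cong2[where f="(*)"] arg_cong[where f=H] arg_cong2[where f=spin]\<close>)
  also have "\<dots> = (\<Sum>x\<in>Pow U. - (spin x v * H x))"
  proof (rule sum.cong)
    fix x
    have "H (sym_diff x C) = H x"
      using CS A edges cluster by (intro H edge_parity_sym_diff) auto
    then show "spin (sym_diff x C) v * H (sym_diff x C) = - (spin x v * H x)"
      using \<open>v \<in> C\<close> by (simp add: spin_def)
  qed simp
  finally show ?thesis by (simp add: sum_negf)
qed

text \<open>\<open>q x y\<close> is the probability of the observations \<open>y\<close> given the
  configuration \<open>x\<close>. Two Cauchy-Schwarz inequalities, one over the connecting sets
  \<open>A\<close> and one over \<open>x\<close>, give the bound. The sums over \<open>x\<close> are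
  unnormalised and the left side is squared, whence the extra factor \<open>2 ^ card U\<close> on
  the right.\<close>

lemma finite_percolation_bound:
  fixes g :: "'v set \<Rightarrow> 'v set set \<Rightarrow> real" and \<theta> :: real
  assumes "finite U" and "finite F" and "v \<in> U" and "\<theta>\<^sup>2 \<le> 1"
    and edges: "\<And>e. e \<in> F \<Longrightarrow> e \<subseteq> U \<and> card e = 2"
  defines "q \<equiv> \<lambda>x y. \<Prod>e\<in>F. (1 + \<theta> * edge_parity x e * spin y e) / 2"
  shows "(\<Sum>x\<in>Pow U. \<Sum>y\<in>Pow F. q x y * (spin x v * g (x \<inter> S) y))\<^sup>2
    \<le> (\<Sum>A | A \<subseteq> F \<and> connects F A v S. \<Prod>e\<in>F. if e \<in> A then \<theta>\<^sup>2 else 1 - \<theta>\<^sup>2)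
      * (2 ^ card U * (\<Sum>x\<in>Pow U. \<Sum>y\<in>Pow F. q x y * (g (x \<inter> S) y)\<^sup>2))"
proof -
  define s where "s = sqrt (1 - \<theta>\<^sup>2)"
  have s2: "s * s = 1 - \<theta>\<^sup>2" using assms(4) by (simp add: s_def)
  \<comment> \<open>\<open>H A\<close> is \<open>\<theta> ^ card A\<close> times the function \<open>h_A\<close> of the introduction, which avoids dividing by \<open>\<theta> = 0\<close>;
    accordingly \<open>\<E>[h_A]\<close> becomes \<open>\<Sum>A. \<alpha> A * \<beta> A * H A\<close>, where \<open>(\<alpha> A)\<^sup>2\<close> is the weight of \<open>A\<close> in \<open>ER\<close>.\<close>
  define \<kappa> where "\<kappa> = (\<lambda>A x y. \<Prod>e\<in>F. if e \<in> A then (\<theta> + spin y e * edge_parity x e) / 2 else (1::real) / 2)"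
  define H where "H = (\<lambda>A x. \<Sum>y\<in>Pow F. \<kappa> A x y * g (x \<inter> S) y)"
  define K where "K = (\<lambda>A. \<Sum>x\<in>Pow U. spin x v * H A x)"
  define \<alpha> where "\<alpha> = (\<lambda>A. \<Prod>e\<in>F. if e \<in> A then \<theta> else s)"
  define \<beta> where "\<beta> = (\<lambda>A. \<Prod>e\<in>F. if e \<in> A then 1 else s)"
  let ?C = "{A. A \<subseteq> F \<and> connects F A v S}"
  have finC: "finite ?C" using \<open>finite F\<close> by simp
  \<comment> \<open>On a single edge this is \<open>\<theta> * (\<theta> + t) / 2 + (1 -
    \<theta>\<^sup>2) / 2 = (1 + \<theta> * t) / 2\<close>, where \<open>t\<close> is the observed
    sign times the true parity.\<close>
  have first: "(\<Sum>A\<in>Pow F. \<alpha> A * \<beta> A * \<kappa> A x y) = q x y" for x y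
  proof -
    have "\<alpha> A * \<beta> A * \<kappa> A x y = (\<Prod>e\<in>F. if e \<in> A then \<theta> * ((\<theta> + spin y e * edge_parity x e) / 2) else (s * s) * (1/2))" for A
      unfolding \<alpha>_def \<beta>_def \<kappa>_def prod.distrib[symmetric] by (intro prod.cong) auto
    then show ?thesis unfolding q_def
      by (simp add: sum_Pow_prod_if[OF \<open>finite F\<close>] s2)
         (intro prod.cong refl, simp add: field_simps power2_eq_square)
  qed
  \<comment> \<open>On a single edge with true parity \<open>T\<close> and signs \<open>a\<close>,
    \<open>c\<close>, the open and closed terms add up to
    \<open>(1 + \<theta> * T * (a + c) + a * c) / 4\<close>. This is 0 for opposite signs, so the
    cross terms disappear and the second moment is exactly that of \<open>g\<close>.\<close>
  have second: "(\<Sum>A\<in>Pow F. (\<beta> A)\<^sup>2 * (\<kappa> A x y * \<kappa> A x y')) = (if y = y' then q x y else 0)"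
    if y: "y \<in> Pow F" "y' \<in> Pow F" for x y y'
  proof -
    have "(\<beta> A)\<^sup>2 * (\<kappa> A x y * \<kappa> A x y') = (\<Prod>e\<in>F. if e \<in> A
        then (\<theta> + spin y e * edge_parity x e) * (\<theta> + spin y' e * edge_parity x e) / 4 else (s * s) * (1/4))" for A
      unfolding \<beta>_def \<kappa>_def prod.distrib[symmetric] power2_eq_square by (intro prod.cong) auto
    then have "(\<Sum>A\<in>Pow F. (\<beta> A)\<^sup>2 * (\<kappa> A x y * \<kappa> A x y')) =
       (\<Prod>e\<in>F. (\<theta> + spin y e * edge_parity x e) * (\<theta> + spin y' e * edge_parity x e) / 4 + (s * s) * (1/4))"
      by (simp add: sum_Pow_prod_if[OF \<open>finite F\<close>])
    also have "\<dots> = (\<Prod>e\<in>F. (1 + \<theta> * edge_parity x e * (spin y e + spin y' e) + spin y e * spin y' e) / 4)"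
    proof (intro prod.cong refl)
      fix e
      have "spin y e * edge_parity x e * (spin y' e * edge_parity x e) = spin y e * spin y' e"
        using edge_parity_square[of x e] by algebra
      then show "(\<theta> + spin y e * edge_parity x e) * (\<theta> + spin y' e * edge_parity x e) / 4 + (s * s) * (1/4)
        = (1 + \<theta> * edge_parity x e * (spin y e + spin y' e) + spin y e * spin y' e) / 4"
        unfolding s2 by (simp add: field_simps power2_eq_square)
    qed
    also have "\<dots> = (if y = y' then q x y else 0)"
    proof (cases "y = y'")
      case True
      then show ?thesis by (auto simp: q_def field_simps intro!: prod.cong)
    next
      case False
      then obtain e where "e \<in> F" "e \<in> y \<longleftrightarrow> e \<notin> y'" using y by blast
      then have "(1 + \<theta> * edge_parity x e * (spin y e + spin y' e) + spin y e * spin y' e) / 4 = 0"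
        by (auto simp: spin_def)
      then show ?thesis using False \<open>e \<in> F\<close> \<open>finite F\<close> by (auto intro!: prod_zero)
    qed
    finally show ?thesis .
  qed
  have mean: "(\<Sum>A\<in>Pow F. \<alpha> A * \<beta> A * H A x) = (\<Sum>y\<in>Pow F. q x y * g (x \<inter> S) y)" for x
  proof -
    have "(\<Sum>A\<in>Pow F. \<alpha> A * \<beta> A * H A x) = (\<Sum>A\<in>Pow F. \<Sum>y\<in>Pow F. \<alpha> A * \<beta> A * \<kappa> A x y * g (x \<inter> S) y)"
      by (simp add: H_def sum_distrib_left mult.assoc)
    also have "\<dots> = (\<Sum>y\<in>Pow F. (\<Sum>A\<in>Pow F. \<alpha> A * \<beta> A * \<kappa> A x y) * g (x \<inter> S) y)"
      by (subst sum.swap) (simp add: sum_distrib_right)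
    finally show ?thesis by (simp add: first)
  qed
  have second_moment: "(\<Sum>A\<in>Pow F. (\<beta> A)\<^sup>2 * (H A x)\<^sup>2) = (\<Sum>y\<in>Pow F. q x y * (g (x \<inter> S) y)\<^sup>2)" for x
  proof -
    let ?g = "\<lambda>y. g (x \<inter> S) y"
    have "(\<Sum>A\<in>Pow F. (\<beta> A)\<^sup>2 * (H A x)\<^sup>2)
      = (\<Sum>A\<in>Pow F. \<Sum>y\<in>Pow F. \<Sum>y'\<in>Pow F. (\<beta> A)\<^sup>2 * (\<kappa> A x y * \<kappa> A x y') * (?g y * ?g y'))"
      unfolding H_def power2_eq_square[of "sum _ _"] sum_product
      unfolding sum_distrib_left by (intro sum.cong refl) (simp add: algebra_simps)
    also have "\<dots> = (\<Sum>y\<in>Pow F. \<Sum>A\<in>Pow F. \<Sum>y'\<in>Pow F. (\<beta> A)\<^sup>2 * (\<kappa> A x y * \<kappa> A x y') * (?g y * ?g y'))"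
      by (rule sum.swap)
    also have "\<dots> = (\<Sum>y\<in>Pow F. \<Sum>y'\<in>Pow F. (\<Sum>A\<in>Pow F. (\<beta> A)\<^sup>2 * (\<kappa> A x y * \<kappa> A x y')) * (?g y * ?g y'))"
      unfolding sum_distrib_right by (rule sum.cong[OF refl]) (rule sum.swap)
    also have "\<dots> = (\<Sum>y\<in>Pow F. \<Sum>y'\<in>Pow F. if y' = y then q x y * (?g y * ?g y) else 0)"
      by (intro sum.cong refl) (simp add: second)
    also have "\<dots> = (\<Sum>y\<in>Pow F. q x y * (?g y)\<^sup>2)"
      using \<open>finite F\<close> by (simp add: power2_eq_square)
    finally show ?thesis .
  qed
  \<comment> \<open>Closed edges contribute the constant 1/2 to \<open>\<kappa>\<close>, so
    \<open>H A\<close> sees \<open>x\<close> only through \<open>x \<inter> S\<close> and the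
    parities of the open edges.\<close>
  have K0: "K A = 0" if "A \<subseteq> F" "\<not> connects F A v S" for A
    unfolding K_def
  proof (rule sum_spin_eq_0_if_not_connects[OF assms(1,3) that(1) edges that(2)])
    fix x x' :: "'v set"
    assume eq: "x \<inter> S = x' \<inter> S" "\<And>e. e \<in> A \<Longrightarrow> edge_parity x e = edge_parity x' e"
    have "\<kappa> A x y = \<kappa> A x' y" for y
      unfolding \<kappa>_def by (intro prod.cong) (auto simp: eq(2))
    then show "H A x = H A x'" by (simp add: H_def eq(1))
  qed
  have K2: "(K A)\<^sup>2 \<le> 2 ^ card U * (\<Sum>x\<in>Pow U. (H A x)\<^sup>2)" for A
  proof -
    have "(K A)\<^sup>2 \<le> (\<Sum>x\<in>Pow U. (spin x v)\<^sup>2) * (\<Sum>x\<in>Pow U. (H A x)\<^sup>2)"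
      unfolding K_def by (rule Cauchy_Schwarz_ineq_sum)
    also have "(\<Sum>x\<in>Pow U. (spin x v)\<^sup>2) = 2 ^ card U"
      using \<open>finite U\<close> by (simp add: power2_eq_square card_Pow)
    finally show ?thesis .
  qed
  have "(\<Sum>x\<in>Pow U. \<Sum>y\<in>Pow F. q x y * (spin x v * g (x \<inter> S) y))
    = (\<Sum>x\<in>Pow U. spin x v * (\<Sum>A\<in>Pow F. \<alpha> A * \<beta> A * H A x))"
    unfolding mean by (simp add: sum_distrib_left algebra_simps)
  also have "\<dots> = (\<Sum>A\<in>Pow F. \<alpha> A * (\<beta> A * K A))"
    unfolding K_def sum_distrib_left by (subst sum.swap) (simp add: algebra_simps)
  also have "\<dots> = (\<Sum>A\<in>?C. \<alpha> A * (\<beta> A * K A))"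
    using \<open>finite F\<close> K0 by (intro sum.mono_neutral_right) auto
  finally have "(\<Sum>x\<in>Pow U. \<Sum>y\<in>Pow F. q x y * (spin x v * g (x \<inter> S) y))\<^sup>2 = (\<Sum>A\<in>?C. \<alpha> A * (\<beta> A * K A))\<^sup>2"
    by simp
  \<comment> \<open>The factors are split this way because the squares of \<open>\<alpha>\<close>
    sum to the connection probability, while those of \<open>\<beta> A * K A\<close> are controlled
    by the second moment.\<close>
  also have "\<dots> \<le> (\<Sum>A\<in>?C. (\<alpha> A)\<^sup>2) * (\<Sum>A\<in>?C. (\<beta> A * K A)\<^sup>2)"
    by (rule Cauchy_Schwarz_ineq_sum)
  also have "\<dots> \<le> (\<Sum>A\<in>?C. (\<alpha> A)\<^sup>2) * (2 ^ card U * (\<Sum>x\<in>Pow U. \<Sum>y\<in>Pow F. q x y * (g (x \<inter> S) y)\<^sup>2))"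
  proof (intro mult_left_mono sum_nonneg)
    \<comment> \<open>The restriction to connecting sets is dropped, because
      \<open>second_moment\<close> sums over all of \<open>Pow F\<close>.\<close>
    have "(\<Sum>A\<in>?C. (\<beta> A * K A)\<^sup>2) \<le> (\<Sum>A\<in>Pow F. (\<beta> A * K A)\<^sup>2)"
      using \<open>finite F\<close> by (intro sum_mono2) auto
    also have "\<dots> \<le> (\<Sum>A\<in>Pow F. (\<beta> A)\<^sup>2 * (2 ^ card U * (\<Sum>x\<in>Pow U. (H A x)\<^sup>2)))"
      unfolding power_mult_distrib by (intro sum_mono mult_left_mono K2) simp
    also have "\<dots> = 2 ^ card U * (\<Sum>x\<in>Pow U. \<Sum>A\<in>Pow F. (\<beta> A)\<^sup>2 * (H A x)\<^sup>2)"
      unfolding sum_distrib_left by (subst sum.swap) (simp add: algebra_simps)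
    finally show "(\<Sum>A\<in>?C. (\<beta> A * K A)\<^sup>2) \<le> 2 ^ card U * (\<Sum>x\<in>Pow U. \<Sum>y\<in>Pow F. q x y * (g (x \<inter> S) y)\<^sup>2)"
      by (simp only: second_moment)
  qed simp
  also have "(\<Sum>A\<in>?C. (\<alpha> A)\<^sup>2) = (\<Sum>A\<in>?C. \<Prod>e\<in>F. if e \<in> A then \<theta>\<^sup>2 else 1 - \<theta>\<^sup>2)"
    unfolding \<alpha>_def power2_eq_square prod.distrib[symmetric]
    by (intro sum.cong prod.cong refl) (simp add: s2 power2_eq_square)
  finally show ?thesis .
qed

section \<open>Binary divergence\<close>

text \<open>The function is artanh, with derivative \<open>1 / (1 - x\<^sup>2)\<close>; it returns
  as the derivative of the entropy expression in \<open>symmetric_entropy_le\<close>.\<close>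

lemma convex_artanh: "convex_on {0..<1} (\<lambda>x::real. (ln (1 + x) - ln (1 - x)) / 2)"
proof (rule f''_ge0_imp_convex)
  show "((\<lambda>x. (ln (1 + x) - ln (1 - x)) / 2) has_real_derivative 1 / (1 - x\<^sup>2)) (at x)"
    if "x \<in> {0..<1}" for x :: real
  proof -
    have "x * x < 1" using that mult_strict_mono[of x 1 x 1] by (cases "x = 0") auto
    then show ?thesis using that
      by (auto intro!: derivative_eq_intros simp: divide_simps power2_eq_square) (auto simp: algebra_simps)
  qed
  show "((\<lambda>x. 1 / (1 - x\<^sup>2)) has_real_derivative 2 * x / (1 - x\<^sup>2)\<^sup>2) (at x)"
    if "x \<in> {0..<1}" for x :: real
  proof -
    have "x * x < 1" using that mult_strict_mono[of x 1 x 1] by (cases "x = 0") auto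
    then show ?thesis using that
      by (auto intro!: derivative_eq_intros simp: divide_simps power2_eq_square)
  qed
qed auto

text \<open>The difference of the two sides vanishes at 0 and tends to 0 at 1. If it were negative
  at \<open>m\<close>, its derivative would be negative at some earlier point and, by convexity of
  artanh, would stay nonpositive from there on, so the difference could not return to 0.\<close>

lemma symmetric_entropy_le:
  fixes m :: real
  assumes "0 \<le> m" and "m < 1"
  shows "((1 + m) * ln (1 + m) + (1 - m) * ln (1 - m)) / 2 \<le> m\<^sup>2 * ln 2"
proof (rule ccontr)
  define D where "D = (\<lambda>x::real. x\<^sup>2 * ln 2 - ((1 + x) * ln (1 + x) + (1 - x) * ln (1 - x)) / 2)"
  define L where "L = (\<lambda>x::real. (ln (1 + x) - ln (1 - x)) / 2)"
  assume "\<not> ?thesis"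
  then have neg: "D m < 0" by (simp add: D_def)
  have "m > 0" using neg assms by (cases "m = 0") (auto simp: D_def)
  have deriv: "(D has_real_derivative 2 * x * ln 2 - L x) (at x)" if "0 \<le> x" "x < 1" for x
  proof -
    have "1 + x \<noteq> 0" "1 - x \<noteq> 0" using that by auto
    then show ?thesis unfolding D_def L_def using that
      by (auto intro!: derivative_eq_intros)
  qed
  obtain a where a: "0 < a" "a < m" "D m - D 0 = (m - 0) * (2 * a * ln 2 - L a)"
    using MVT2[OF \<open>m > 0\<close>, of D "\<lambda>x. 2 * x * ln 2 - L x"] deriv assms by auto
  have La: "2 * a * ln 2 < L a"
  proof -
    have "(m - 0) * (2 * a * ln 2 - L a) < 0" using a(3) neg by (simp add: D_def)
    then show ?thesis using \<open>m > 0\<close> by (simp add: mult_less_0_iff)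
  qed
  have decreasing: "2 * x * ln 2 - L x \<le> 0" if "a \<le> x" "x < 1" for x
  proof -
    \<comment> \<open>Convexity on the chord from 0, where \<open>L\<close> vanishes, makes
      \<open>L x / x\<close> nondecreasing, so that \<open>L a / a > 2 * ln 2\<close> persists
      beyond \<open>a\<close>.\<close>
    have "L ((1 - a / x) *\<^sub>R 0 + (a / x) *\<^sub>R x) \<le> (1 - a / x) * L 0 + (a / x) * L x"
      unfolding L_def using convex_onD[OF convex_artanh, of "a / x" 0 x] that a by (auto simp: field_simps)
    then have "L a \<le> (a / x) * L x" using that a by (simp add: L_def)
    with La have "2 * a * ln 2 < (a / x) * L x" by linarith
    then show ?thesis using that a by (simp add: field_simps)
  qed
  have "D x \<le> D m" if "m \<le> x" "x < 1" for x
    using that a decreasing deriv by (intro DERIV_nonpos_imp_nonincreasing[OF that(1)]) force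
  then have "eventually (\<lambda>x. D x \<le> D m) (at_left 1)"
    using assms by (auto simp: eventually_at_left[of m 1] intro!: exI[of _ m])
  moreover have "(D \<longlongrightarrow> 0) (at_left 1)" unfolding D_def by real_asymp
  ultimately have "0 \<le> D m" by (intro tendsto_upperbound) auto
  with neg show False by simp
qed

text \<open>The left side is the divergence of Bern(f) from the fair coin. With
  \<open>m = 2 * f - 1\<close> it becomes the expression in \<open>symmetric_entropy_le\<close>, and
  exchanging \<open>f\<close> with \<open>1 - f\<close> reduces to nonnegative
  \<open>m\<close>.\<close>

lemma binary_divergence_le:
  fixes f b :: real
  assumes "1 < b" and "0 \<le> f" and "f \<le> 1"
  shows "f * log b (2 * f) + (1 - f) * log b (2 * (1 - f)) \<le> (2 * f - 1)\<^sup>2 * log b 2"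
proof -
  have main: "f * ln (2 * f) + (1 - f) * ln (2 * (1 - f)) \<le> (2 * f - 1)\<^sup>2 * ln 2"
    if "1 / 2 \<le> f" "f \<le> 1" for f :: real
  \<comment> \<open>The value \<open>f = 1\<close> means \<open>m = 1\<close>, outside the range of
    \<open>symmetric_entropy_le\<close>; both sides are then \<open>ln 2\<close>, since the term
    with \<open>ln 0\<close> has the factor 0.\<close>
  proof (cases "f = 1")
    case False
    then have "f * ln (2 * f) + (1 - f) * ln (2 * (1 - f)) =
        ((1 + (2 * f - 1)) * ln (1 + (2 * f - 1)) + (1 - (2 * f - 1)) * ln (1 - (2 * f - 1))) / 2"
      by (simp add: field_simps)
    also have "\<dots> \<le> (2 * f - 1)\<^sup>2 * ln 2"
      using that False by (intro symmetric_entropy_le) auto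
    finally show ?thesis .
  qed simp
  have "f * ln (2 * f) + (1 - f) * ln (2 * (1 - f)) \<le> (2 * f - 1)\<^sup>2 * ln 2"
  proof (cases "1 / 2 \<le> f")
    case True
    then show ?thesis using main assms by blast
  next
    case False
    then have "(1 - f) * ln (2 * (1 - f)) + f * ln (2 * f) \<le> (2 * (1 - f) - 1)\<^sup>2 * ln 2"
      using main[of "1 - f"] assms by simp
    moreover have "(2 * (1 - f) - 1)\<^sup>2 = (2 * f - 1)\<^sup>2" by algebra
    ultimately show ?thesis by simp
  qed
  then have "(f * ln (2 * f) + (1 - f) * ln (2 * (1 - f))) / ln b \<le> (2 * f - 1)\<^sup>2 * ln 2 / ln b"
    using \<open>1 < b\<close> by (intro divide_right_mono) auto
  then show ?thesis by (simp add: log_def add_divide_distrib)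
qed

section \<open>Approximation by an algebra of sets\<close>

text \<open>Approximability passes to complements, which have the same symmetric difference, and to
  countable unions, which continuity of the measure truncates to finite ones. Induction over the
  generated sigma-algebra does the rest.\<close>

lemma (in finite_measure) sets_approx_by_algebra:
  assumes "algebra (space M) \<A>" and gen: "sets M = sigma_sets (space M) \<A>"
    and "A \<in> sets M" and "0 < \<epsilon>"
  shows "\<exists>C\<in>\<A>. measure M (sym_diff A C) < \<epsilon>"
proof -
  interpret algebra "space M" \<A> by fact
  have \<A>[measurable_dest]: "C \<in> sets M" if "C \<in> \<A>" for C using that gen by auto
  have "A \<in> sigma_sets (space M) \<A>" using assms by simp
  then show ?thesis using \<open>0 < \<epsilon>\<close>
  proof (induction arbitrary: \<epsilon>)
    case (Basic A)
    then show ?case by (intro bexI[of _ A]) auto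
  next
    case Empty
    then show ?case by (intro bexI[of _ "{}"]) auto
  next
    case (Compl A)
    then obtain C where C: "C \<in> \<A>" "measure M (sym_diff A C) < \<epsilon>" by blast
    have "sym_diff (space M - A) (space M - C) = sym_diff A C"
      using C(1) Compl.hyps gen \<A> sets.sets_into_space[of A M] sets.sets_into_space[of C M] by auto
    with C show ?case by (intro bexI[of _ "space M - C"]) auto
  next
    case (Union A)
    have A[measurable]: "A i \<in> sets M" for i using Union.hyps gen by simp
    let ?B = "\<lambda>n. \<Union>i<n. A i"
    have "(\<lambda>n. measure M (?B n)) \<longlonglongrightarrow> measure M (\<Union>n. ?B n)"
      by (intro finite_Lim_measure_incseq) (auto simp: incseq_def intro: less_le_trans)
    moreover have "(\<Union>n. ?B n) = (\<Union>i. A i)" by auto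
    ultimately have "eventually (\<lambda>n. measure M (\<Union>i. A i) - \<epsilon> / 2 < measure M (?B n)) sequentially"
      using Union.prems by (intro order_tendstoD(1)) auto
    then obtain n where n: "measure M (\<Union>i. A i) - \<epsilon> / 2 < measure M (?B n)"
      by (auto simp: eventually_sequentially)
    have n': "measure M ((\<Union>i. A i) - ?B n) < \<epsilon> / 2"
      using n by (subst finite_measure_Diff) auto
    \<comment> \<open>The \<open>n\<close> pieces with this error each stay within
      \<open>\<epsilon> / 2\<close> in total; the \<open>+ 1\<close> keeps the denominator positive
      when \<open>n = 0\<close>.\<close>
    have "\<exists>C\<in>\<A>. measure M (sym_diff (A i) C) < \<epsilon> / (2 * (n + 1))" for i
      using Union.prems by (intro Union.IH) auto
    then obtain C where C: "\<And>i. C i \<in> \<A>" "\<And>i. measure M (sym_diff (A i) (C i)) < \<epsilon> / (2 * (n + 1))"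
      by metis
    have [measurable]: "C i \<in> sets M" for i using C by auto
    have "measure M (sym_diff (\<Union>i. A i) (\<Union>i<n. C i))
        \<le> measure M (((\<Union>i. A i) - ?B n) \<union> (\<Union>i<n. sym_diff (A i) (C i)))"
      by (intro finite_measure_mono) auto
    also have "\<dots> \<le> measure M ((\<Union>i. A i) - ?B n) + measure M (\<Union>i<n. sym_diff (A i) (C i))"
      by (intro measure_subadditive) auto
    also have "measure M (\<Union>i<n. sym_diff (A i) (C i)) \<le> (\<Sum>i<n. measure M (sym_diff (A i) (C i)))"
      by (intro finite_measure_subadditive_finite) auto
    also have "\<dots> \<le> (\<Sum>i<n. \<epsilon> / (2 * (n + 1)))"
      by (intro sum_mono less_imp_le C)
    also have "\<dots> \<le> \<epsilon> / 2" using Union.prems by (simp add: field_simps)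
    finally show ?case using C n' by (intro bexI[of _ "\<Union>i<n. C i"]) auto
  qed
qed

text \<open>Indicators are handled by \<open>sets_approx_by_algebra\<close>, sums by halving the
  error, and limits by dominated convergence. The class \<open>G\<close> is kept abstract, to be
  instantiated by cylinder functions.\<close>

lemma (in finite_measure) integrable_approx_by_algebra:
  fixes f :: "'a \<Rightarrow> real"
  assumes "algebra (space M) \<A>" and "sets M = sigma_sets (space M) \<A>"
    and ind: "\<And>A. A \<in> \<A> \<Longrightarrow> G (indicator A :: 'a \<Rightarrow> real)"
    and add: "\<And>g h. G g \<Longrightarrow> G h \<Longrightarrow> G (\<lambda>x. g x + h x)"
    and scale: "\<And>g c. G g \<Longrightarrow> G (\<lambda>x. g x * c)"
    and int: "\<And>g. G g \<Longrightarrow> integrable M g"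
    and "integrable M f" and "0 < \<epsilon>"
  shows "\<exists>g. G g \<and> (\<integral>x. \<bar>f x - g x\<bar> \<partial>M) < \<epsilon>"
  using assms(7,8)
proof (induction arbitrary: \<epsilon> rule: integrable_induct)
  case (base A c)
  note [measurable] = base(1)
  \<comment> \<open>Dividing by \<open>\<bar>c\<bar> + 1\<close> instead of
    \<open>\<bar>c\<bar>\<close> covers \<open>c = 0\<close>.\<close>
  have "0 < \<epsilon> / (\<bar>c\<bar> + 1)" using base by simp
  then obtain C where C: "C \<in> \<A>" "measure M (sym_diff A C) < \<epsilon> / (\<bar>c\<bar> + 1)"
    using sets_approx_by_algebra[OF assms(1,2) base(1)] by blast
  have [measurable]: "C \<in> sets M" using C assms(2) by auto
  have "(\<integral>x. \<bar>indicator A x *\<^sub>R c - indicator C x * c\<bar> \<partial>M) = (\<integral>x. indicator (sym_diff A C) x * \<bar>c\<bar> \<partial>M)"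
    by (intro Bochner_Integration.integral_cong) (auto simp: indicator_def)
  also have "\<dots> = measure M (sym_diff A C) * \<bar>c\<bar>" by simp
  also have "\<dots> \<le> measure M (sym_diff A C) * (\<bar>c\<bar> + 1)" by (intro mult_left_mono) auto
  also have "\<dots> < \<epsilon>" using C(2) by (simp add: field_simps)
  finally show ?case using C by (intro exI[of _ "\<lambda>x. indicator C x * c"]) (auto intro: scale ind)
next
  case (add f1 f2)
  obtain g1 g2 where g: "G g1" "(\<integral>x. \<bar>f1 x - g1 x\<bar> \<partial>M) < \<epsilon> / 2" "G g2" "(\<integral>x. \<bar>f2 x - g2 x\<bar> \<partial>M) < \<epsilon> / 2"
    using add.IH[of "\<epsilon> / 2"] add.prems by auto
  have [simp]: "integrable M g1" "integrable M g2" using g int by auto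
  have "(\<integral>x. \<bar>(f1 x + f2 x) - (g1 x + g2 x)\<bar> \<partial>M) \<le> (\<integral>x. \<bar>f1 x - g1 x\<bar> + \<bar>f2 x - g2 x\<bar> \<partial>M)"
    using add.hyps by (intro integral_mono) auto
  also have "\<dots> < \<epsilon>" using g add.hyps by simp
  finally show ?case using g by (intro exI[of _ "\<lambda>x. g1 x + g2 x"]) (auto intro: assms)
next
  case (lim f s)
  have "(\<lambda>i. \<integral>x. \<bar>f x - s i x\<bar> \<partial>M) \<longlonglongrightarrow> (\<integral>x. 0 \<partial>M)"
  \<comment> \<open>The approximants supplied by the induction rule are bounded by
    \<open>2 * \<bar>f x\<bar>\<close>, whence the factor 3.\<close>
  proof (rule integral_dominated_convergence[where w="\<lambda>x. 3 * \<bar>f x\<bar>"])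
    show "AE x in M. (\<lambda>i. \<bar>f x - s i x\<bar>) \<longlonglongrightarrow> 0"
      using lim.hyps(2) by (intro AE_I2 tendsto_rabs_zero) (auto intro!: tendsto_eq_intros)
    show "AE x in M. norm \<bar>f x - s i x\<bar> \<le> 3 * \<bar>f x\<bar>" for i
      using lim.hyps(3)[of _ i] by (intro AE_I2) fastforce
  qed (use lim in auto)
  then have "eventually (\<lambda>i. (\<integral>x. \<bar>f x - s i x\<bar> \<partial>M) < \<epsilon> / 2) sequentially"
    using lim.prems by (intro order_tendstoD(2)) auto
  then obtain i where i: "(\<integral>x. \<bar>f x - s i x\<bar> \<partial>M) < \<epsilon> / 2"
    by (auto simp: eventually_sequentially)
  obtain g where g: "G g" "(\<integral>x. \<bar>s i x - g x\<bar> \<partial>M) < \<epsilon> / 2"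
    using lim.IH[of "\<epsilon> / 2"] lim.prems by auto
  have [simp]: "integrable M g" using g int by auto
  have "(\<integral>x. \<bar>f x - g x\<bar> \<partial>M) \<le> (\<integral>x. \<bar>f x - s i x\<bar> + \<bar>s i x - g x\<bar> \<partial>M)"
    using lim by (intro integral_mono) auto
  also have "\<dots> < \<epsilon>" using g i lim by simp
  finally show ?case using g by blast
qed

section \<open>Mutual information of a fair coin\<close>

text \<open>\<open>m\<close> is a version of the conditional mean of the sign of \<open>B\<close>
  given \<open>W\<close>. Relative to counting measure times the law of \<open>W\<close>, the pair
  has as density the conditional probability of \<open>B = c\<close>, and the product of the
  marginals has density 1/2. The information is therefore the mean divergence of the conditional law
  of \<open>B\<close> from a fair coin.\<close>

lemma (in prob_space) mutual_information_coin_le: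
  fixes B :: "'a \<Rightarrow> bool"
  assumes "1 < b" and B: "distr M (count_space UNIV) B = measure_pmf (bernoulli_pmf (1/2))"
    and B_meas [measurable]: "random_variable (count_space UNIV) B" and W [measurable]: "random_variable T W"
  shows "\<exists>m\<in>borel_measurable T. (\<forall>w. \<bar>m w\<bar> \<le> 1)
    \<and> (\<forall>g\<in>borel_measurable T. integrable M (\<lambda>\<omega>. g (W \<omega>)) \<longrightarrow>
        expectation (\<lambda>\<omega>. (if B \<omega> then - 1 else 1) * g (W \<omega>)) = expectation (\<lambda>\<omega>. m (W \<omega>) * g (W \<omega>)))
    \<and> mutual_information b (count_space UNIV) T B W \<le> expectation (\<lambda>\<omega>. (m (W \<omega>))\<^sup>2) * log b 2"
proof -
  interpret information_space M b by standard fact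
  let ?CS = "count_space (UNIV :: bool set)"
  define N where "N = distr M T W"
  have sets_N [measurable_cong]: "sets N = sets T" by (simp add: N_def)
  interpret N: prob_space N unfolding N_def by (rule prob_space_distr) fact
  interpret CS: sigma_finite_measure ?CS by (rule sigma_finite_measure_count_space_finite) simp
  interpret CN: pair_sigma_finite ?CS N ..
  have [measurable]: "B -` {c} \<inter> space M \<in> events" for c by (rule measurable_sets[OF B_meas]) simp
  \<comment> \<open>\<open>\<nu> c\<close> is the law of \<open>W\<close> on the event
    \<open>B = c\<close>, left unnormalised so that the two measures add up to
    \<open>N\<close>.\<close>
  define \<nu> where "\<nu> = (\<lambda>c. distr (density M (\<lambda>\<omega>. ennreal (indicator (B -` {c} \<inter> space M) \<omega>))) T W)"
  have sets_\<nu>: "sets (\<nu> c) = sets N" for c by (simp add: \<nu>_def N_def)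
  have emeasure_\<nu>: "emeasure (\<nu> c) A = emeasure M {\<omega>\<in>space M. B \<omega> = c \<and> W \<omega> \<in> A}" if [measurable]: "A \<in> sets T" for c A
  proof -
    have "emeasure (\<nu> c) A = emeasure (density M (\<lambda>\<omega>. ennreal (indicator (B -` {c} \<inter> space M) \<omega>))) (W -` A \<inter> space M)"
      unfolding \<nu>_def by (subst emeasure_distr) auto
    also have "\<dots> = (\<integral>\<^sup>+\<omega>. ennreal (indicator (B -` {c} \<inter> space M) \<omega>) * indicator (W -` A \<inter> space M) \<omega> \<partial>M)"
      by (rule emeasure_density) (use measurable_sets[OF W that] in measurable)
    also have "\<dots> = (\<integral>\<^sup>+\<omega>. indicator {\<omega>\<in>space M. B \<omega> = c \<and> W \<omega> \<in> A} \<omega> \<partial>M)"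
      by (intro nn_integral_cong) (auto simp: indicator_def)
    also have "\<dots> = emeasure M {\<omega>\<in>space M. B \<omega> = c \<and> W \<omega> \<in> A}"
      by (rule nn_integral_indicator) measurable
    finally show ?thesis .
  qed
  have \<nu>_add: "emeasure (\<nu> True) A + emeasure (\<nu> False) A = emeasure N A" if [measurable]: "A \<in> sets T" for A
  proof -
    have "emeasure (\<nu> True) A + emeasure (\<nu> False) A
      = emeasure M ({\<omega>\<in>space M. B \<omega> = True \<and> W \<omega> \<in> A} \<union> {\<omega>\<in>space M. B \<omega> = False \<and> W \<omega> \<in> A})"
      unfolding emeasure_\<nu>[OF that] by (rule plus_emeasure) (measurable, auto)
    also have "\<dots> = emeasure N A" unfolding N_def
      by (subst emeasure_distr) (auto intro!: arg_cong[where f="emeasure M"])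
    finally show ?thesis .
  qed
  \<comment> \<open>Domination by \<open>N\<close> gives absolute continuity; the Radon-Nikodym
    density is the conditional probability of \<open>B = c\<close> given \<open>W\<close>.\<close>
  have "\<exists>D\<in>borel_measurable N. density N (\<lambda>w. ennreal (D w)) = \<nu> c \<and> (\<forall>w. 0 \<le> D w)" for c
  proof -
    have fin: "finite_measure (\<nu> c)"
      using emeasure_\<nu>[of "space T" c] by (intro finite_measureI) (simp add: \<nu>_def)
    have "emeasure (\<nu> c) A \<le> emeasure N A" if "A \<in> sets T" for A
      using \<nu>_add[OF that] by (cases c) (metis le_iff_add add.commute)+
    then have ac: "absolutely_continuous N (\<nu> c)"
      by (auto simp: absolutely_continuous_def null_sets_def sets_\<nu> sets_N) (metis le_zero_eq)
    obtain D where D: "D \<in> borel_measurable N" "AE w in N. RN_deriv N (\<nu> c) w = ennreal (D w)" "\<And>w. 0 \<le> D w"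
      using N.real_RN_deriv[OF fin ac sets_\<nu>] by metis
    have "density N (\<lambda>w. ennreal (D w)) = density N (RN_deriv N (\<nu> c))"
      using D by (intro density_cong) auto
    also have "\<dots> = \<nu> c" using ac sets_\<nu> by (rule N.density_RN_deriv)
    finally show ?thesis using D by blast
  qed
  then obtain D where D[measurable]: "\<And>c. D c \<in> borel_measurable N"
    and density_D: "\<And>c. density N (\<lambda>w. ennreal (D c w)) = \<nu> c" and D_nonneg: "\<And>c w. 0 \<le> D c w"
    by metis
  have [measurable]: "D c \<in> borel_measurable T" for c using D[of c] by (simp cong: measurable_cong_sets add: sets_N)
  have "density N (\<lambda>w. ennreal (D True w) + ennreal (D False w)) = density N (\<lambda>w. 1)"
  proof (rule measure_eqI)
    fix A assume "A \<in> sets (density N (\<lambda>w. ennreal (D True w) + ennreal (D False w)))"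
    then have A[measurable]: "A \<in> sets T" by (simp add: sets_N)
    have "emeasure (density N (\<lambda>w. ennreal (D True w) + ennreal (D False w))) A
        = emeasure (density N (\<lambda>w. ennreal (D True w))) A + emeasure (density N (\<lambda>w. ennreal (D False w))) A"
      by (simp add: emeasure_density nn_integral_add distrib_right)
    also have "\<dots> = emeasure N A" unfolding density_D by (rule \<nu>_add[OF A])
    finally show "emeasure (density N (\<lambda>w. ennreal (D True w) + ennreal (D False w))) A = emeasure (density N (\<lambda>w. 1)) A"
      by (simp add: density_1)
  qed simp
  then have "AE w in N. ennreal (D True w) + ennreal (D False w) = 1"
    by (intro N.density_unique) auto
  then have D_sum: "AE w in N. D True w + D False w = 1"
    by (rule AE_mp) (auto simp: D_nonneg simp flip: ennreal_plus)
  \<comment> \<open>Clamping, and taking the second density as a complement, turns the bounds and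
    the sum 1 into pointwise facts; the densities change only on a null set.\<close>
  define f where "f = (\<lambda>c w. if c then max 0 (min 1 (D True w)) else 1 - max 0 (min 1 (D True w)))"
  have f_meas[measurable]: "f c \<in> borel_measurable T" for c unfolding f_def by measurable
  have f_bounds: "0 \<le> f c w" "f c w \<le> 1" for c w by (auto simp: f_def)
  have density_f: "density N (\<lambda>w. ennreal (f c w)) = \<nu> c" for c
    unfolding density_D[symmetric] using D_sum
  proof (intro density_cong)
    show "AE w in N. ennreal (f c w) = ennreal (D c w)"
      using D_sum
    proof eventually_elim
      case (elim w)
      then have "f c w = D c w"
        using D_nonneg[of True w] D_nonneg[of False w] by (cases c) (auto simp: f_def)
      then show ?case by simp
    qed
  qed measurable
  have expectation_N: "expectation (\<lambda>\<omega>. h (W \<omega>)) = (\<integral>w. h w \<partial>N)" if [measurable]: "h \<in> borel_measurable T" for h :: "_ \<Rightarrow> real"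
    unfolding N_def by (simp add: integral_distr)
  have N1: "distr M N W = N" unfolding N_def by (rule distr_cong) auto

  \<comment> \<open>The bit \<open>True\<close> has sign -1, so the conditional mean is
    \<open>f False w - f True w\<close>.\<close>
  define m where "m = (\<lambda>w. 1 - 2 * f True w)"
  have m_meas[measurable]: "m \<in> borel_measurable T" by (simp add: m_def)
  have m_bound: "\<bar>m w\<bar> \<le> 1" for w using f_bounds[of True w] by (auto simp: m_def)
  have m_cond: "expectation (\<lambda>\<omega>. (if B \<omega> then - 1 else 1) * g (W \<omega>)) = expectation (\<lambda>\<omega>. m (W \<omega>) * g (W \<omega>))"
    if g[measurable]: "g \<in> borel_measurable T" and int: "integrable M (\<lambda>\<omega>. g (W \<omega>))" for g
  proof -
    have "expectation (\<lambda>\<omega>. indicator (B -` {True} \<inter> space M) \<omega> * g (W \<omega>)) = (\<integral>w. g w \<partial>\<nu> True)"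
      unfolding \<nu>_def by (subst integral_distr) (auto simp: integral_real_density)
    also have "\<dots> = (\<integral>w. f True w * g w \<partial>N)"
      unfolding density_f[symmetric] by (subst integral_real_density) (auto simp: f_bounds)
    also have "\<dots> = expectation (\<lambda>\<omega>. f True (W \<omega>) * g (W \<omega>))"
      by (rule expectation_N[symmetric]) measurable
    finally have 1: "expectation (\<lambda>\<omega>. indicator (B -` {True} \<inter> space M) \<omega> * g (W \<omega>)) = expectation (\<lambda>\<omega>. f True (W \<omega>) * g (W \<omega>))" .
    have i1: "integrable M (\<lambda>\<omega>. indicator (B -` {True} \<inter> space M) \<omega> * g (W \<omega>))"
      by (intro Bochner_Integration.integrable_bound[OF int]) (auto simp: indicator_def)
    have i2: "integrable M (\<lambda>\<omega>. f True (W \<omega>) * g (W \<omega>))"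
      by (intro Bochner_Integration.integrable_bound[OF int])
         (auto simp: abs_mult f_bounds intro!: mult_left_le_one_le)
    have "expectation (\<lambda>\<omega>. (if B \<omega> then - 1 else 1) * g (W \<omega>))
      = expectation (\<lambda>\<omega>. g (W \<omega>) - 2 * (indicator (B -` {True} \<inter> space M) \<omega> * g (W \<omega>)))"
      by (intro Bochner_Integration.integral_cong) (auto simp: indicator_def)
    also have "\<dots> = expectation (\<lambda>\<omega>. g (W \<omega>)) - 2 * expectation (\<lambda>\<omega>. f True (W \<omega>) * g (W \<omega>))"
      using i1 int unfolding 1[symmetric] by (subst Bochner_Integration.integral_diff) auto
    also have "\<dots> = expectation (\<lambda>\<omega>. g (W \<omega>) - 2 * (f True (W \<omega>) * g (W \<omega>)))"
      using i2 int by simp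
    also have "\<dots> = expectation (\<lambda>\<omega>. m (W \<omega>) * g (W \<omega>))"
      by (simp add: m_def algebra_simps)
    finally show ?thesis .
  qed

  \<comment> \<open>The law \<open>N\<close> itself serves as reference measure for
    \<open>W\<close>, which then has density 1; no reference measure on \<open>T\<close> has to be
    supplied.\<close>
  have joint: "distributed M (?CS \<Otimes>\<^sub>M N) (\<lambda>\<omega>. (B \<omega>, W \<omega>)) (\<lambda>z. ennreal (f (fst z) (snd z)))"
    unfolding distributed_def
  proof (intro conjI)
    show meas: "(\<lambda>z. ennreal (f (fst z) (snd z))) \<in> borel_measurable (?CS \<Otimes>\<^sub>M N)"
      unfolding f_def by measurable
    show "distr M (?CS \<Otimes>\<^sub>M N) (\<lambda>\<omega>. (B \<omega>, W \<omega>)) = density (?CS \<Otimes>\<^sub>M N) (\<lambda>z. ennreal (f (fst z) (snd z)))"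
    proof (rule measure_eqI)
      fix A assume "A \<in> sets (distr M (?CS \<Otimes>\<^sub>M N) (\<lambda>\<omega>. (B \<omega>, W \<omega>)))"
      then have A[measurable]: "A \<in> sets (?CS \<Otimes>\<^sub>M N)" by simp
      have AT: "Pair c -` A \<in> sets T" for c using sets_Pair1[OF A, of c] by (simp add: sets_N)
      note [measurable] = AT[of True] AT[of False]
      have "emeasure (density (?CS \<Otimes>\<^sub>M N) (\<lambda>z. ennreal (f (fst z) (snd z)))) A
        = (\<integral>\<^sup>+c. \<integral>\<^sup>+w. ennreal (f c w) * indicator A (c, w) \<partial>N \<partial>?CS)"
        using meas by (subst emeasure_density) (auto simp flip: N.nn_integral_fst)
      also have "\<dots> = (\<Sum>c\<in>UNIV. \<integral>\<^sup>+w. ennreal (f c w) * indicator (Pair c -` A) w \<partial>N)"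
        by (subst nn_integral_count_space_finite) (auto simp: indicator_def vimage_def)
      also have "\<dots> = (\<Sum>c\<in>UNIV. emeasure (\<nu> c) (Pair c -` A))"
        unfolding density_f[symmetric] using AT by (subst emeasure_density) (auto simp: sets_N)
      also have "\<dots> = emeasure M {\<omega>\<in>space M. B \<omega> = True \<and> W \<omega> \<in> Pair True -` A}
         + emeasure M {\<omega>\<in>space M. B \<omega> = False \<and> W \<omega> \<in> Pair False -` A}"
        unfolding emeasure_\<nu>[OF AT] by (simp add: UNIV_bool add.commute)
      also have "\<dots> = emeasure M ({\<omega>\<in>space M. B \<omega> = True \<and> W \<omega> \<in> Pair True -` A}
         \<union> {\<omega>\<in>space M. B \<omega> = False \<and> W \<omega> \<in> Pair False -` A})"
        by (rule plus_emeasure) (measurable, auto)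
      also have "\<dots> = emeasure (distr M (?CS \<Otimes>\<^sub>M N) (\<lambda>\<omega>. (B \<omega>, W \<omega>))) A"
        by (subst emeasure_distr) (auto intro!: arg_cong[where f="emeasure M"], metis+)
      finally show "emeasure (distr M (?CS \<Otimes>\<^sub>M N) (\<lambda>\<omega>. (B \<omega>, W \<omega>))) A
        = emeasure (density (?CS \<Otimes>\<^sub>M N) (\<lambda>z. ennreal (f (fst z) (snd z)))) A" by simp
    qed simp
  qed measurable
  have distB: "distributed M ?CS B (\<lambda>_. ennreal (1/2))"
    unfolding distributed_def B measure_pmf_eq_density
    by (auto intro!: density_cong AE_I2)
  have distW: "distributed M N W (\<lambda>_. ennreal 1)"
    unfolding distributed_def N1 by (simp add: density_1)
  define \<phi> where "\<phi> = (\<lambda>z. f (fst z) (snd z) * log b (f (fst z) (snd z) / (1 / 2 * 1)))"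
  have "mutual_information b ?CS T B W = mutual_information b ?CS N B W"
    unfolding mutual_information_def N1 unfolding N_def
    by (intro arg_cong2[where f="KL_divergence b"] distr_cong refl sets_pair_measure_cong) auto
  also have "\<dots> = integral\<^sup>L (?CS \<Otimes>\<^sub>M N) \<phi>"
    unfolding \<phi>_def
    using mutual_information_distr[OF CS.sigma_finite_measure_axioms N.sigma_finite_measure_axioms distB _ distW _ joint]
    by (simp add: f_bounds)
  also have "\<dots> \<le> expectation (\<lambda>\<omega>. (m (W \<omega>))\<^sup>2) * log b 2"
  \<comment> \<open>A non-integrable function has Bochner integral 0 by convention, and the right
    side is nonnegative.\<close>
  proof (cases "integrable (?CS \<Otimes>\<^sub>M N) \<phi>")
    case False
    then show ?thesis using \<open>1 < b\<close> by (simp add: not_integrable_integral_eq)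
  next
    case True
    have "AE c in ?CS. integrable N (\<lambda>w. \<phi> (c, w))" using CN.AE_integrable_fst'[OF True] .
    then have int: "integrable N (\<lambda>w. \<phi> (c, w))" for c by (simp add: AE_count_space)
    have "integral\<^sup>L (?CS \<Otimes>\<^sub>M N) \<phi> = (\<Sum>c\<in>UNIV. \<integral>w. \<phi> (c, w) \<partial>N)"
      using CN.integral_fst'[OF True] by (simp add: lebesgue_integral_count_space_finite)
    also have "\<dots> = (\<integral>w. \<phi> (True, w) + \<phi> (False, w) \<partial>N)"
      using int by (simp add: UNIV_bool add.commute)
    also have "\<dots> \<le> (\<integral>w. (m w)\<^sup>2 * log b 2 \<partial>N)"
    proof (rule integral_mono)
      show "integrable N (\<lambda>w. (m w)\<^sup>2 * log b 2)"
        using m_bound by (intro integrable_mult_left N.integrable_const_bound[of _ 1]) (auto simp: abs_square_le_1)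
      show "\<phi> (True, w) + \<phi> (False, w) \<le> (m w)\<^sup>2 * log b 2" for w
      proof -
        have "f False w = 1 - f True w" by (simp add: f_def)
        moreover have "(1 - 2 * f True w)\<^sup>2 = (2 * f True w - 1)\<^sup>2" by algebra
        ultimately show ?thesis
          using binary_divergence_le[OF \<open>1 < b\<close> f_bounds[of True w]] by (simp add: \<phi>_def m_def mult.commute)
      qed
    qed (use int in simp)
    also have "\<dots> = expectation (\<lambda>\<omega>. (m (W \<omega>))\<^sup>2) * log b 2"
      by (subst expectation_N) simp_all
    finally show ?thesis .
  qed
  finally show ?thesis using m_meas m_bound m_cond by blast
qed

section \<open>Percolation\<close>

lemma pred_ER_component: "e \<in> E \<Longrightarrow> Measurable.pred (ER E p) (\<lambda>\<omega>. \<omega> e)"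
  unfolding ER_def by measurable

text \<open>A path has some finite length and its intermediate vertices lie in the countable set
  \<open>\<Union>E\<close>, so the event is built from countably many coordinate events.\<close>

lemma pred_open_path:
  assumes "countable E" and "\<And>e. e \<in> E \<Longrightarrow> finite e"
  shows "Measurable.pred (ER E p) (\<lambda>\<omega>. (a, c) \<in> (open_adj E \<omega>)\<^sup>*)"
proof -
  have "countable (\<Union>E)" using assms by (intro countable_UN[of E "\<lambda>e. e", simplified]) (auto intro: countable_finite)
  have step: "Measurable.pred (ER E p) (\<lambda>\<omega>. (a, c) \<in> open_adj E \<omega>)" for a c
    unfolding open_adj_def by (cases "{a, c} \<in> E") (auto intro: pred_ER_component)
  have "Measurable.pred (ER E p) (\<lambda>\<omega>. (a, c) \<in> open_adj E \<omega> ^^ n)" for n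
  proof (induction n arbitrary: c)
    case (Suc n)
    have "(a, c) \<in> open_adj E \<omega> ^^ Suc n \<longleftrightarrow> (\<exists>d\<in>\<Union>E. (a, d) \<in> open_adj E \<omega> ^^ n \<and> (d, c) \<in> open_adj E \<omega>)" for \<omega>
    proof -
      have "d \<in> \<Union>E" if "(d, c) \<in> open_adj E \<omega>" for d using that by (auto simp: open_adj_def)
      then show ?thesis by (auto simp: relcomp_unfold)
    qed
    moreover have "Measurable.pred (ER E p) (\<lambda>\<omega>. \<exists>d\<in>\<Union>E. (a, d) \<in> open_adj E \<omega> ^^ n \<and> (d, c) \<in> open_adj E \<omega>)"
      using \<open>countable (\<Union>E)\<close> Suc.IH step by (intro measurable_pred_countable pred_intros_logic)
    ultimately show ?case by (simp only:)
  qed simp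
  then show ?thesis unfolding rtrancl_power by measurable
qed

text \<open>\<open>S\<close> is an arbitrary set, but only \<open>v\<close> and endpoints of edges
  can be reached, so the union over targets becomes countable.\<close>

lemma pred_open_connection:
  assumes "countable E" and "\<And>e. e \<in> E \<Longrightarrow> finite e"
  shows "Measurable.pred (ER E p) (\<lambda>\<omega>. \<exists>u\<in>S. (v, u) \<in> (open_adj E \<omega>)\<^sup>*)"
proof -
  have "countable (\<Union>E)" using assms by (intro countable_UN[of E "\<lambda>e. e", simplified]) (auto intro: countable_finite)
  have "u \<in> insert v (\<Union>E)" if "(v, u) \<in> (open_adj E \<omega>)\<^sup>*" for u \<omega>
    using that by (induction) (auto simp: open_adj_def)
  then have eq: "(\<lambda>\<omega>. \<exists>u\<in>S. (v, u) \<in> (open_adj E \<omega>)\<^sup>*) = (\<lambda>\<omega>. \<exists>u\<in>S \<inter> insert v (\<Union>E). (v, u) \<in> (open_adj E \<omega>)\<^sup>*)"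
    by (intro ext) blast
  show ?thesis
    unfolding eq
  proof (rule measurable_pred_countable(2))
    show "countable (S \<inter> insert v (\<Union>E))"
      using \<open>countable (\<Union>E)\<close> by (rule countable_Int2[OF countable_insert])
  qed (rule pred_open_path[OF assms])
qed

text \<open>A connection inside \<open>F\<close> is also one in \<open>E\<close>, and the events
  prescribing the open edges of \<open>F\<close> are disjoint cylinders with product probabilities.
  This one inequality suffices; no limit over \<open>F\<close> is taken.\<close>

lemma perc_ge_finite:
  assumes "countable E" and "\<And>e. e \<in> E \<Longrightarrow> finite e"
    and "finite F" and "F \<subseteq> E" and "S' \<subseteq> S" and "0 \<le> p" and "p \<le> 1"
  shows "(\<Sum>A | A \<subseteq> F \<and> connects F A v S'. \<Prod>e\<in>F. if e \<in> A then p else 1 - p) \<le> perc E p v S"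
proof -
  interpret product_prob_space "\<lambda>_. measure_pmf (bernoulli_pmf p)" E by standard
  interpret ER: prob_space "ER E p" unfolding ER_def by (rule P.prob_space_axioms)
  define cyl where "cyl = (\<lambda>A. prod_emb E (\<lambda>_. measure_pmf (bernoulli_pmf p)) F (\<Pi>\<^sub>E e\<in>F. {e \<in> A}))"
  have cyl: "\<omega> \<in> cyl A \<longleftrightarrow> \<omega> \<in> space (ER E p) \<and> (\<forall>e\<in>F. \<omega> e = (e \<in> A))" for A \<omega>
    using \<open>F \<subseteq> E\<close> by (auto simp: cyl_def prod_emb_def ER_def space_PiM PiE_iff)
  have cyl_sets: "cyl A \<in> sets (ER E p)" for A
    unfolding cyl_def ER_def using assms by (intro sets_PiM_I) auto
  have cyl_prob: "measure (ER E p) (cyl A) = (\<Prod>e\<in>F. if e \<in> A then p else 1 - p)" for A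
    unfolding cyl_def ER_def using assms
    by (subst measure_PiM_emb) (auto simp: measure_pmf_single intro!: prod.cong)
  let ?C = "{A. A \<subseteq> F \<and> connects F A v S'}"
  have "(\<Sum>A\<in>?C. \<Prod>e\<in>F. if e \<in> A then p else 1 - p) = measure (ER E p) (\<Union>A\<in>?C. cyl A)"
    unfolding cyl_prob[symmetric]
  proof (rule measure_finite_Union[symmetric])
    show "disjoint_family_on cyl ?C"
      unfolding disjoint_family_on_def
    proof (intro ballI impI)
      fix A A' assume "A \<in> ?C" "A' \<in> ?C" "A \<noteq> A'"
      then obtain e where "e \<in> F" "e \<in> A \<longleftrightarrow> e \<notin> A'" by blast
      then show "cyl A \<inter> cyl A' = {}" by (auto simp: cyl)
    qed
    show "finite ?C" using \<open>finite F\<close> by simp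
    show "emeasure (ER E p) (cyl A) \<noteq> \<infinity>" for A
      by simp
    show "cyl ` ?C \<subseteq> sets (ER E p)" using cyl_sets by blast
  qed
  also have "\<dots> \<le> perc E p v S"
    unfolding perc_def
  proof (rule ER.finite_measure_mono)
    show "{\<omega> \<in> space (ER E p). \<exists>u\<in>S. (v, u) \<in> (open_adj E \<omega>)\<^sup>*} \<in> ER.events"
      using pred_open_connection[OF assms(1,2), where p=p and v=v and S=S] unfolding pred_def .
    show "(\<Union>A\<in>?C. cyl A) \<subseteq> {\<omega> \<in> space (ER E p). \<exists>u\<in>S. (v, u) \<in> (open_adj E \<omega>)\<^sup>*}"
    proof safe
      fix \<omega> A assume \<omega>: "\<omega> \<in> cyl A" and "connects F A v S'"
      then obtain u where u: "u \<in> S'" "(v, u) \<in> (open_adj F (\<lambda>e. e \<in> A))\<^sup>*"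
        by (auto simp: connects_def)
      have "open_adj F (\<lambda>e. e \<in> A) \<subseteq> open_adj E \<omega>"
        using \<omega> \<open>F \<subseteq> E\<close> by (auto simp: cyl open_adj_def)
      with u(2) have "(v, u) \<in> (open_adj E \<omega>)\<^sup>*" using rtrancl_mono by blast
      with u(1) \<open>S' \<subseteq> S\<close> show "\<exists>u\<in>S. (v, u) \<in> (open_adj E \<omega>)\<^sup>*" by blast
    qed (simp add: cyl)
  qed
  finally show ?thesis .
qed

section \<open>Noisy parity observations\<close>

text \<open>Packing finitely many predicates into one discrete random set makes every function of
  them measurable.\<close>

lemma measurable_Collect_finite:
  assumes "finite I" and P: "\<And>i. i \<in> I \<Longrightarrow> Measurable.pred M (P i)"
  shows "(\<lambda>x. {i\<in>I. P i x}) \<in> measurable M (count_space (Pow I))"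
proof -
  have "(\<lambda>x. {i\<in>I. P i x}) -` {K} \<inter> space M \<in> sets M" if "K \<in> Pow I" for K
  proof -
    have "(\<lambda>x. {i\<in>I. P i x}) -` {K} \<inter> space M = {x\<in>space M. \<forall>i\<in>I. if i \<in> K then P i x else \<not> P i x}"
      using that by auto
    also have "\<dots> \<in> sets M"
      unfolding pred_def[symmetric]
    proof (rule pred_intros_finite(3)[OF \<open>finite I\<close>])
      show "Measurable.pred M (\<lambda>x. if i \<in> K then P i x else \<not> P i x)" if "i \<in> I" for i
        using P[OF that] pred_intros_logic(2)[OF P[OF that]] by (cases "i \<in> K") (simp_all only: if_True if_False)
    qed
    finally show ?thesis .
  qed
  then show ?thesis
    unfolding measurable_count_space_eq2[OF finite_Pow_iff[THEN iffD2, OF \<open>finite I\<close>]] by blast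
qed

lemma borel_measurable_finite_configurations:
  fixes h :: "'i set \<Rightarrow> 'j set \<Rightarrow> real"
  assumes "finite I" "\<And>i. i \<in> I \<Longrightarrow> Measurable.pred M (P i)"
    and "finite J" "\<And>j. j \<in> J \<Longrightarrow> Measurable.pred M (Q j)"
  shows "(\<lambda>x. h {i\<in>I. P i x} {j\<in>J. Q j x}) \<in> borel_measurable M"
proof (rule measurable_compose_countable'[where g="\<lambda>x. {i\<in>I. P i x}" and I="Pow I" and f="\<lambda>K x. h K {j\<in>J. Q j x}"])
  show "(\<lambda>x. h K {j\<in>J. Q j x}) \<in> borel_measurable M" for K
    by (rule measurable_compose[OF measurable_Collect_finite[OF assms(3,4)] borel_measurable_count_space])
  show "(\<lambda>x. {i\<in>I. P i x}) \<in> measurable M (count_space (Pow I))"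
    by (rule measurable_Collect_finite[OF assms(1,2)])
  show "countable (Pow I)" using assms(1) by (intro countable_finite) simp
qed

locale noisy_parity_observations = prob_space M for M :: "'a measure" +
  fixes V :: "'v set" and E :: "'v set set"
    and X :: "'v \<Rightarrow> 'a \<Rightarrow> bool" and Z :: "'v set \<Rightarrow> 'a \<Rightarrow> bool" and Y :: "'v set \<Rightarrow> 'a \<Rightarrow> bool"
    and \<delta> :: real
  assumes countable_V: "countable V" and graph: "simple_graph V E"
    and \<delta>: "0 \<le> \<delta>" "\<delta> \<le> 1"
    and indep: "indep_vars (\<lambda>_. count_space UNIV)
          (\<lambda>i. case i of Inl u \<Rightarrow> X u | Inr e \<Rightarrow> Z e) (Inl ` V \<union> Inr ` E)"
    and distX: "\<And>u. u \<in> V \<Longrightarrow> distr M (count_space UNIV) (X u) = measure_pmf (bernoulli_pmf (1/2))"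
    and distZ: "\<And>e. e \<in> E \<Longrightarrow> distr M (count_space UNIV) (Z e) = measure_pmf (bernoulli_pmf \<delta>)"
    and Y_edge: "\<And>u w \<omega>. {u, w} \<in> E \<Longrightarrow> \<omega> \<in> space M \<Longrightarrow>
          Y {u, w} \<omega> = ((X u \<omega> \<noteq> X w \<omega>) \<noteq> Z {u, w} \<omega>)"
begin

definition \<theta> :: real where "\<theta> = 1 - 2 * \<delta>"

lemma \<theta>_le_1: "\<theta>\<^sup>2 \<le> 1"
  unfolding abs_square_le_1 using \<delta> by (simp add: \<theta>_def abs_if)

lemma edge:
  assumes "e \<in> E"
  shows "e \<subseteq> V" and "card e = 2" and "finite e"
proof -
  obtain u w where "e = {u, w}" "u \<in> V" "w \<in> V" "u \<noteq> w"
    using assms graph unfolding simple_graph_def by blast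
  then show "e \<subseteq> V" and "card e = 2" and "finite e" by auto
qed

lemma countable_E: "countable E"
proof -
  have "E \<subseteq> (\<lambda>(u, w). {u, w}) ` (V \<times> V)" using graph by (auto simp: simple_graph_def)
  then show ?thesis by (rule countable_subset) (intro countable_image countable_SIGMA countable_V)
qed

lemma measurable_X [measurable]: "u \<in> V \<Longrightarrow> Measurable.pred M (X u)"
  using indep unfolding indep_vars_def by force

lemma measurable_Z [measurable]: "e \<in> E \<Longrightarrow> Measurable.pred M (Z e)"
  using indep unfolding indep_vars_def by force

text \<open>An edge has exactly two ends, so their exclusive or is the parity of the number of ends
  carrying a 1, the form used in \<open>edge_parity\<close>.\<close>

lemma Y_parity:
  assumes "e \<in> E" and "e \<subseteq> U" and "\<omega> \<in> space M"
  shows "Y e \<omega> \<longleftrightarrow> odd (card (e \<inter> {u\<in>U. X u \<omega>})) \<noteq> Z e \<omega>"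
proof -
  obtain u w where e: "e = {u, w}" "u \<noteq> w" using edge(2)[OF assms(1)] by (meson card_2_iff)
  have "e \<inter> {u\<in>U. X u \<omega>} = (if X u \<omega> then {u} else {}) \<union> (if X w \<omega> then {w} else {})"
    using assms(2) e by auto
  then have "odd (card (e \<inter> {u\<in>U. X u \<omega>})) \<longleftrightarrow> X u \<omega> \<noteq> X w \<omega>" using e(2) by auto
  with Y_edge assms e show ?thesis by auto
qed

lemma measurable_Y [measurable]:
  assumes "e \<in> E"
  shows "Measurable.pred M (Y e)"
proof -
  obtain u w where e: "e = {u, w}" "u \<noteq> w" using edge(2)[OF assms] by (meson card_2_iff)
  then have "Measurable.pred M (X u)" "Measurable.pred M (X w)" "Measurable.pred M (Z e)"
    using edge(1)[OF assms] assms by auto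
  then have "Measurable.pred M (\<lambda>\<omega>. (X u \<omega> \<noteq> X w \<omega>) \<noteq> Z e \<omega>)"
    by (intro pred_intros_logic(2,6))
  moreover have "Measurable.pred M (Y e) \<longleftrightarrow> Measurable.pred M (\<lambda>\<omega>. (X u \<omega> \<noteq> X w \<omega>) \<noteq> Z e \<omega>)"
    by (rule measurable_cong) (use Y_edge assms e in simp)
  ultimately show ?thesis by simp
qed

section \<open>Joint law of finitely many bits and observations\<close>

lemma prob_X: "u \<in> V \<Longrightarrow> prob (X u -` {c} \<inter> space M) = 1 / 2"
  using measure_distr[OF measurable_X, of u "{c}"] distX[of u] by (simp add: measure_pmf_single)

lemma prob_Z: "e \<in> E \<Longrightarrow> prob (Z e -` {c} \<inter> space M) = (if c then \<delta> else 1 - \<delta>)"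
  using measure_distr[OF measurable_Z, of e "{c}"] distZ[of e] \<delta> by (cases c) (simp_all add: measure_pmf_single)

text \<open>Once the bits on \<open>U\<close> are fixed, \<open>Y e\<close> and \<open>Z e\<close>
  determine each other, so the event prescribes the values of independent bits and noises.\<close>

lemma prob_configuration:
  assumes "finite U" and "U \<subseteq> V" and "U \<noteq> {}" and "finite F" and "F \<subseteq> E"
    and edges: "\<And>e. e \<in> F \<Longrightarrow> e \<subseteq> U" and "x \<subseteq> U" and "y \<subseteq> F"
  shows "prob {\<omega>\<in>space M. {u\<in>U. X u \<omega>} = x \<and> {e\<in>F. Y e \<omega>} = y}
    = (1 / 2) ^ card U * (\<Prod>e\<in>F. (1 + \<theta> * edge_parity x e * spin y e) / 2)"
proof -
  let ?W = "\<lambda>i. case i of Inl u \<Rightarrow> X u | Inr e \<Rightarrow> Z e"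
  \<comment> \<open>This is the noise value forced by solving \<open>Y e = parity xor Z e\<close>
    for \<open>Z e\<close>.\<close>
  let ?z = "\<lambda>e. e \<in> y \<longleftrightarrow> even (card (e \<inter> x))"
  define a where "a = (\<lambda>i. case i of Inl u \<Rightarrow> u \<in> x | Inr e \<Rightarrow> ?z e)"
  let ?J = "Inl ` U \<union> Inr ` F"
  \<comment> \<open>Since \<open>U\<close> is nonempty, the indexed intersection stays inside
    \<open>space M\<close>.\<close>
  have "{\<omega>\<in>space M. {u\<in>U. X u \<omega>} = x \<and> {e\<in>F. Y e \<omega>} = y} = (\<Inter>i\<in>?J. ?W i -` {a i} \<inter> space M)"
    (is "?L = ?R")
  proof (intro set_eqI iffI)
    fix \<omega> assume \<omega>: "\<omega> \<in> ?L"
    then have x: "{u\<in>U. X u \<omega>} = x" and y: "{e\<in>F. Y e \<omega>} = y" and sp: "\<omega> \<in> space M" by auto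
    have "X u \<omega> \<longleftrightarrow> u \<in> x" if "u \<in> U" for u using x that by auto
    moreover have "Z e \<omega> \<longleftrightarrow> ?z e" if "e \<in> F" for e
      using Y_parity[of e U \<omega>] that \<open>F \<subseteq> E\<close> edges sp y unfolding x by auto
    ultimately show "\<omega> \<in> ?R" using sp \<open>U \<noteq> {}\<close> by (auto simp: a_def)
  next
    fix \<omega> assume \<omega>: "\<omega> \<in> ?R"
    have mem: "\<omega> \<in> ?W i -` {a i} \<inter> space M" if "i \<in> ?J" for i
      using \<omega> that by (rule INT_D)
    have Xx: "X u \<omega> \<longleftrightarrow> u \<in> x" if "u \<in> U" for u
      using mem[of "Inl u"] that by (simp add: a_def)
    have sp: "\<omega> \<in> space M" using mem \<open>U \<noteq> {}\<close> by blast
    have x: "{u\<in>U. X u \<omega>} = x" using Xx \<open>x \<subseteq> U\<close> by blast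
    have "Y e \<omega> \<longleftrightarrow> e \<in> y" if "e \<in> F" for e
    proof -
      have "Z e \<omega> \<longleftrightarrow> ?z e" using mem[of "Inr e"] that by (simp add: a_def)
      then show ?thesis using Y_parity[of e U \<omega>] that \<open>F \<subseteq> E\<close> edges sp unfolding x by auto
    qed
    then show "\<omega> \<in> ?L" using x sp \<open>y \<subseteq> F\<close> by auto
  qed
  then have "prob ?L = (\<Prod>i\<in>?J. prob (?W i -` {a i} \<inter> space M))"
    using assms by (simp only:) (intro indep_varsD[OF indep], auto)
  also have "\<dots> = (\<Prod>u\<in>U. prob (X u -` {u \<in> x} \<inter> space M)) * (\<Prod>e\<in>F. prob (Z e -` {?z e} \<inter> space M))"
    using assms by (subst prod.union_disjoint) (auto simp: prod.reindex a_def)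
  also have "(\<Prod>u\<in>U. prob (X u -` {u \<in> x} \<inter> space M)) = (1 / 2) ^ card U"
    using \<open>U \<subseteq> V\<close> by (simp add: prob_X subset_iff)
  also have "(\<Prod>e\<in>F. prob (Z e -` {?z e} \<inter> space M)) = (\<Prod>e\<in>F. (1 + \<theta> * edge_parity x e * spin y e) / 2)"
  proof (rule prod.cong)
    fix e assume "e \<in> F"
    then have "prob (Z e -` {?z e} \<inter> space M) = (if ?z e then \<delta> else 1 - \<delta>)"
      using \<open>F \<subseteq> E\<close> by (intro prob_Z) auto
    \<comment> \<open>Here \<open>(1 - \<theta>) / 2 = \<delta>\<close>, and the sign
      \<open>edge_parity x e * spin y e\<close> is -1 exactly when the forced noise is 1.\<close>
    then show "prob (Z e -` {?z e} \<inter> space M) = (1 + \<theta> * edge_parity x e * spin y e) / 2"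
      by (auto simp: \<theta>_def edge_parity_def spin_def field_simps)
  qed simp
  finally show ?thesis .
qed

text \<open>The finitely many configurations partition the space. The resulting double sum is the
  one appearing in \<open>finite_percolation_bound\<close>.\<close>

lemma expectation_configuration:
  fixes \<phi> :: "'v set \<Rightarrow> 'v set set \<Rightarrow> real"
  assumes "finite U" and "U \<subseteq> V" and "U \<noteq> {}" and "finite F" and "F \<subseteq> E"
    and edges: "\<And>e. e \<in> F \<Longrightarrow> e \<subseteq> U"
  shows "expectation (\<lambda>\<omega>. \<phi> {u\<in>U. X u \<omega>} {e\<in>F. Y e \<omega>})
    = (1 / 2) ^ card U * (\<Sum>x\<in>Pow U. \<Sum>y\<in>Pow F. (\<Prod>e\<in>F. (1 + \<theta> * edge_parity x e * spin y e) / 2) * \<phi> x y)"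
proof -
  let ?A = "\<lambda>x y. {\<omega>\<in>space M. {u\<in>U. X u \<omega>} = x \<and> {e\<in>F. Y e \<omega>} = y}"
  have A: "?A x y \<in> events" for x y
  proof -
    have "(\<lambda>\<omega>. (\<lambda>x' y'. if x' = x \<and> y' = y then 1 else 0 :: real) {u\<in>U. X u \<omega>} {e\<in>F. Y e \<omega>}) \<in> borel_measurable M"
      by (rule borel_measurable_finite_configurations[OF \<open>finite U\<close> measurable_X \<open>finite F\<close> measurable_Y])
        (use assms in blast)+
    then have "(\<lambda>\<omega>. (\<lambda>x' y'. if x' = x \<and> y' = y then 1 else 0 :: real) {u\<in>U. X u \<omega>} {e\<in>F. Y e \<omega>}) -` {1} \<inter> space M \<in> events"
      by (rule measurable_sets) simp
    also have "(\<lambda>\<omega>. (\<lambda>x' y'. if x' = x \<and> y' = y then 1 else 0 :: real) {u\<in>U. X u \<omega>} {e\<in>F. Y e \<omega>}) -` {1} \<inter> space M = ?A x y"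
      by (auto split: if_splits)
    finally show ?thesis .
  qed
  have int: "integrable M (\<lambda>\<omega>. indicator (?A x y) \<omega> * \<phi> x y)" for x y
    by (intro integrable_mult_left integrable_real_indicator A) (simp add: less_top[symmetric])
  have expectation_A: "expectation (\<lambda>\<omega>. indicator (?A x y) \<omega> * \<phi> x y) = prob (?A x y) * \<phi> x y" for x y
    using A[of x y] by simp
  have "expectation (\<lambda>\<omega>. \<phi> {u\<in>U. X u \<omega>} {e\<in>F. Y e \<omega>})
    = expectation (\<lambda>\<omega>. \<Sum>x\<in>Pow U. \<Sum>y\<in>Pow F. indicator (?A x y) \<omega> * \<phi> x y)"
  proof (rule Bochner_Integration.integral_cong)
    fix \<omega> assume \<omega>: "\<omega> \<in> space M"
    have "(\<Sum>x\<in>Pow U. \<Sum>y\<in>Pow F. indicator (?A x y) \<omega> * \<phi> x y)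
      = (\<Sum>x\<in>Pow U. \<Sum>y\<in>Pow F. if y = {e\<in>F. Y e \<omega>} then (if x = {u\<in>U. X u \<omega>} then \<phi> x y else 0) else 0)"
      using \<omega> by (intro sum.cong) (auto simp: indicator_def)
    also have "\<dots> = \<phi> {u\<in>U. X u \<omega>} {e\<in>F. Y e \<omega>}"
      using assms by (subst sum.delta, simp, subst if_P, blast, subst sum.delta) auto
    finally show "\<phi> {u\<in>U. X u \<omega>} {e\<in>F. Y e \<omega>} = (\<Sum>x\<in>Pow U. \<Sum>y\<in>Pow F. indicator (?A x y) \<omega> * \<phi> x y)" by simp
  qed simp
  also have "\<dots> = (\<Sum>x\<in>Pow U. \<Sum>y\<in>Pow F. prob (?A x y) * \<phi> x y)"
    by (simp only: Bochner_Integration.integral_sum Bochner_Integration.integrable_sum int expectation_A)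
  also have "\<dots> = (\<Sum>x\<in>Pow U. \<Sum>y\<in>Pow F. (1 / 2) ^ card U * ((\<Prod>e\<in>F. (1 + \<theta> * edge_parity x e * spin y e) / 2) * \<phi> x y))"
    using assms by (intro sum.cong refl) (subst prob_configuration, auto)
  finally show ?thesis by (simp add: sum_distrib_left)
qed

lemma cylinder_correlation_bound:
  fixes g :: "'v set \<Rightarrow> 'v set set \<Rightarrow> real"
  assumes "v \<in> V" and "finite S'" and "S' \<subseteq> S" and "S \<subseteq> V" and "finite F" and "F \<subseteq> E"
  shows "(expectation (\<lambda>\<omega>. (if X v \<omega> then - 1 else 1) * g {u\<in>S'. X u \<omega>} {e\<in>F. Y e \<omega>}))\<^sup>2
    \<le> perc E (\<theta>\<^sup>2) v S * expectation (\<lambda>\<omega>. (g {u\<in>S'. X u \<omega>} {e\<in>F. Y e \<omega>})\<^sup>2)"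
proof -
  \<comment> \<open>Besides \<open>v\<close> and the observed vertices, \<open>U\<close> must
    contain both ends of every observed edge for the parities to be functions of the configuration
    on \<open>U\<close>.\<close>
  define U where "U = insert v (S' \<union> \<Union>F)"
  have "finite (\<Union>F)" "\<Union>F \<subseteq> V" using assms edge by (blast intro: finite_Union)+
  then have U: "finite U" "U \<subseteq> V" "U \<noteq> {}" "\<And>e. e \<in> F \<Longrightarrow> e \<subseteq> U" "v \<in> U"
    using assms by (auto simp: U_def)
  have S': "{u\<in>S'. X u \<omega>} = {u\<in>U. X u \<omega>} \<inter> S'" for \<omega> by (auto simp: U_def)
  have v: "(if X v \<omega> then - 1 else 1 :: real) = spin {u\<in>U. X u \<omega>} v" for \<omega> by (auto simp: U_def spin_def)
  let ?q = "\<lambda>x y. \<Prod>e\<in>F. (1 + \<theta> * edge_parity x e * spin y e) / 2"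
  let ?L = "\<Sum>x\<in>Pow U. \<Sum>y\<in>Pow F. ?q x y * (spin x v * g (x \<inter> S') y)"
  let ?R = "\<Sum>x\<in>Pow U. \<Sum>y\<in>Pow F. ?q x y * (g (x \<inter> S') y)\<^sup>2"
  let ?P = "\<Sum>A | A \<subseteq> F \<and> connects F A v S'. \<Prod>e\<in>F. if e \<in> A then \<theta>\<^sup>2 else 1 - \<theta>\<^sup>2"
  have L: "expectation (\<lambda>\<omega>. (if X v \<omega> then - 1 else 1) * g {u\<in>S'. X u \<omega>} {e\<in>F. Y e \<omega>}) = (1 / 2) ^ card U * ?L"
    unfolding S' v using assms U by (intro expectation_configuration[where \<phi>="\<lambda>x y. spin x v * g (x \<inter> S') y"]) auto
  have R: "expectation (\<lambda>\<omega>. (g {u\<in>S'. X u \<omega>} {e\<in>F. Y e \<omega>})\<^sup>2) = (1 / 2) ^ card U * ?R"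
    unfolding S' using assms U by (intro expectation_configuration[where \<phi>="\<lambda>x y. (g (x \<inter> S') y)\<^sup>2"]) auto
  have "?L\<^sup>2 \<le> ?P * (2 ^ card U * ?R)"
    using assms U edge \<theta>_le_1 by (intro finite_percolation_bound) auto
  then have "((1 / 2) ^ card U * ?L)\<^sup>2 \<le> ((1 / 2) ^ card U)\<^sup>2 * (?P * (2 ^ card U * ?R))"
    unfolding power_mult_distrib by (intro mult_left_mono) auto
  \<comment> \<open>One of the two normalising factors cancels against \<open>2 ^ card U\<close>;
    the other turns \<open>?R\<close> into an expectation.\<close>
  also have "\<dots> = ?P * ((1 / 2) ^ card U * ?R)"
    by (simp add: power2_eq_square power_one_over)
  also have "\<dots> \<le> perc E (\<theta>\<^sup>2) v S * ((1 / 2) ^ card U * ?R)"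
  proof (rule mult_right_mono)
    show "?P \<le> perc E (\<theta>\<^sup>2) v S"
      using assms edge countable_E \<theta>_le_1 by (intro perc_ge_finite) auto
    show "0 \<le> (1 / 2) ^ card U * ?R"
      unfolding R[symmetric] by simp
  qed
  finally show ?thesis unfolding L R .
qed

end

section \<open>Countable graphs\<close>

context noisy_parity_observations
begin

section \<open>The observations as a random element, and cylinder functions of them\<close>

definition obs_space :: "'v set \<Rightarrow> (('v \<Rightarrow> bool) \<times> ('v set \<Rightarrow> bool)) measure" where
  "obs_space S = PiM S (\<lambda>_. count_space UNIV) \<Otimes>\<^sub>M PiM E (\<lambda>_. count_space UNIV)"

definition obs :: "'v set \<Rightarrow> 'a \<Rightarrow> ('v \<Rightarrow> bool) \<times> ('v set \<Rightarrow> bool)" where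
  "obs S \<omega> = (restrict (\<lambda>u. X u \<omega>) S, restrict (\<lambda>e. Y e \<omega>) E)"

text \<open>The finitely many coordinates reach \<open>h\<close> as sets, the encoding of the finite
  bounds. Equality is asked only on the space of extensional functions, where \<open>obs\<close>
  takes its values.\<close>

definition cylinder_function :: "'v set \<Rightarrow> (('v \<Rightarrow> bool) \<times> ('v set \<Rightarrow> bool) \<Rightarrow> real) \<Rightarrow> bool" where
  "cylinder_function S g \<longleftrightarrow> (\<exists>S' F h. finite S' \<and> S' \<subseteq> S \<and> finite F \<and> F \<subseteq> E
    \<and> (\<forall>w\<in>space (obs_space S). g w = h {u\<in>S'. fst w u} {e\<in>F. snd w e}))"

lemma measurable_obs: "S \<subseteq> V \<Longrightarrow> obs S \<in> measurable M (obs_space S)"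
  unfolding obs_def obs_space_def
  by (intro measurable_Pair measurable_restrict) (auto intro: measurable_X measurable_Y)

lemma measurable_fst_obs: "u \<in> S \<Longrightarrow> Measurable.pred (obs_space S) (\<lambda>w. fst w u)"
  unfolding obs_space_def by measurable

lemma measurable_snd_obs: "e \<in> E \<Longrightarrow> Measurable.pred (obs_space S) (\<lambda>w. snd w e)"
  unfolding obs_space_def by measurable

lemma borel_measurable_cylinder_function:
  assumes "cylinder_function S g"
  shows "g \<in> borel_measurable (obs_space S)"
proof -
  obtain S' F h where g: "finite S'" "S' \<subseteq> S" "finite F" "F \<subseteq> E"
    "\<And>w. w \<in> space (obs_space S) \<Longrightarrow> g w = h {u\<in>S'. fst w u} {e\<in>F. snd w e}"
    using assms unfolding cylinder_function_def by blast
  have "(\<lambda>w. h {u\<in>S'. fst w u} {e\<in>F. snd w e}) \<in> borel_measurable (obs_space S)"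
    by (rule borel_measurable_finite_configurations[OF g(1) measurable_fst_obs g(3) measurable_snd_obs]) (use g in blast)+
  then show ?thesis using g(5) by (subst measurable_cong) auto
qed

lemma cylinder_function_bounded:
  assumes "cylinder_function S g"
  shows "\<exists>B. \<forall>w\<in>space (obs_space S). \<bar>g w\<bar> \<le> B"
proof -
  obtain S' F h where g: "finite S'" "finite F"
    "\<And>w. w \<in> space (obs_space S) \<Longrightarrow> g w = h {u\<in>S'. fst w u} {e\<in>F. snd w e}"
    using assms unfolding cylinder_function_def by blast
  let ?R = "(\<lambda>(x, y). \<bar>h x y\<bar>) ` (Pow S' \<times> Pow F)"
  have "\<bar>g w\<bar> \<le> Max ?R" if "w \<in> space (obs_space S)" for w
    unfolding g(3)[OF that] using g(1,2) by (intro Max_ge) auto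
  then show ?thesis by blast
qed

text \<open>Both functions are read on the union of their coordinate sets, and intersections recover
  the part belonging to each. An arbitrary \<open>f\<close> covers sums, scaling, truncation and
  Boolean operations at once.\<close>

lemma cylinder_function_combine:
  assumes "cylinder_function S g1" and "cylinder_function S g2"
  shows "cylinder_function S (\<lambda>w. f (g1 w) (g2 w))"
proof -
  obtain S1 F1 h1 where 1: "finite S1" "S1 \<subseteq> S" "finite F1" "F1 \<subseteq> E"
    "\<And>w. w \<in> space (obs_space S) \<Longrightarrow> g1 w = h1 {u\<in>S1. fst w u} {e\<in>F1. snd w e}"
    using assms(1) unfolding cylinder_function_def by blast
  obtain S2 F2 h2 where 2: "finite S2" "S2 \<subseteq> S" "finite F2" "F2 \<subseteq> E"
    "\<And>w. w \<in> space (obs_space S) \<Longrightarrow> g2 w = h2 {u\<in>S2. fst w u} {e\<in>F2. snd w e}"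
    using assms(2) unfolding cylinder_function_def by blast
  have restr: "{i\<in>I \<union> J. P i} \<inter> I = {i\<in>I. P i}" "{i\<in>I \<union> J. P i} \<inter> J = {i\<in>J. P i}" for I J :: "'i set" and P
    by auto
  show ?thesis unfolding cylinder_function_def
    by (rule exI[of _ "S1 \<union> S2"], rule exI[of _ "F1 \<union> F2"],
        rule exI[of _ "\<lambda>x y. f (h1 (x \<inter> S1) (y \<inter> F1)) (h2 (x \<inter> S2) (y \<inter> F2))"])
       (simp add: restr 1 2 del: Un_iff)
qed

definition cylinder_sets :: "'v set \<Rightarrow> (('v \<Rightarrow> bool) \<times> ('v set \<Rightarrow> bool)) set set" where
  "cylinder_sets S = {C. C \<subseteq> space (obs_space S) \<and> cylinder_function S (indicator C)}"

lemma algebra_cylinder_sets: "algebra (space (obs_space S)) (cylinder_sets S)"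
  unfolding algebra_iff_Un
proof (intro conjI ballI)
  show "cylinder_sets S \<subseteq> Pow (space (obs_space S))" by (auto simp: cylinder_sets_def)
  show "{} \<in> cylinder_sets S"
    by (auto simp: cylinder_sets_def cylinder_function_def intro!: exI[of _ "{}"] exI[of _ "\<lambda>_ _. 0"])
next
  fix C assume "C \<in> cylinder_sets S"
  then have C: "cylinder_function S (indicator C :: _ \<Rightarrow> real)" by (simp add: cylinder_sets_def)
  have "cylinder_function S (\<lambda>w. 1 - indicator C w)"
    using cylinder_function_combine[OF C C, of "\<lambda>a b. 1 - a"] .
  then have "cylinder_function S (indicator (space (obs_space S) - C) :: _ \<Rightarrow> real)"
    unfolding cylinder_function_def by (simp add: indicator_diff)
  then show "space (obs_space S) - C \<in> cylinder_sets S" by (auto simp: cylinder_sets_def)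
next
  fix C D assume "C \<in> cylinder_sets S" "D \<in> cylinder_sets S"
  then have CD: "C \<subseteq> space (obs_space S)" "D \<subseteq> space (obs_space S)"
    "cylinder_function S (indicator C :: _ \<Rightarrow> real)" "cylinder_function S (indicator D :: _ \<Rightarrow> real)"
    by (auto simp: cylinder_sets_def)
  have "cylinder_function S (\<lambda>w. max (indicator C w) (indicator D w))"
    using cylinder_function_combine[OF CD(3,4), of max] .
  also have "(\<lambda>w. max (indicator C w) (indicator D w)) = (indicator (C \<union> D) :: _ \<Rightarrow> real)"
    by (auto simp: indicator_def fun_eq_iff)
  finally show "C \<union> D \<in> cylinder_sets S" using CD by (simp add: cylinder_sets_def)
qed

text \<open>One inclusion holds because cylinder functions are measurable. For the other, each
  coordinate is a cylinder function, so the identity is measurable from the generated sigma-algebra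
  into the product.\<close>

lemma sets_obs_space: "sets (obs_space S) = sigma_sets (space (obs_space S)) (cylinder_sets S)"
proof
  define N where "N = sigma (space (obs_space S)) (cylinder_sets S)"
  have sub: "cylinder_sets S \<subseteq> Pow (space (obs_space S))" by (auto simp: cylinder_sets_def)
  have cyl: "C \<in> sets (obs_space S)" if C: "C \<in> cylinder_sets S" for C
  proof -
    have "indicator C -` {1 :: real} \<inter> space (obs_space S) \<in> sets (obs_space S)"
      using C borel_measurable_cylinder_function[of S "indicator C"]
      by (intro measurable_sets[of _ _ borel]) (auto simp: cylinder_sets_def)
    also have "indicator C -` {1 :: real} \<inter> space (obs_space S) = C"
      using C by (auto simp: cylinder_sets_def indicator_def)
    finally show ?thesis .
  qed
  then show "sigma_sets (space (obs_space S)) (cylinder_sets S) \<subseteq> sets (obs_space S)"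
    by (intro sets.sigma_sets_subset) auto
  have coordinate: "Measurable.pred N P"
    if P: "cylinder_function S (indicator {w\<in>space (obs_space S). P w} :: _ \<Rightarrow> real)" for P
  proof -
    have "{w\<in>space (obs_space S). P w} \<in> cylinder_sets S" using P by (auto simp: cylinder_sets_def)
    then show ?thesis using sub by (simp add: N_def pred_def space_measure_of sets_measure_of sigma_sets.Basic)
  qed
  have "(\<lambda>w. w) \<in> measurable N (obs_space S)"
    unfolding obs_space_def
  proof (subst measurable_pair_iff, intro conjI)
    show "fst \<circ> (\<lambda>w. w) \<in> measurable N (PiM S (\<lambda>_. count_space UNIV))"
    proof (rule measurable_PiM_single')
      show "(\<lambda>w. (fst \<circ> (\<lambda>w. w)) w u) \<in> measurable N (count_space UNIV)" if "u \<in> S" for u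
        unfolding comp_def
      proof (rule coordinate)
        show "cylinder_function S (indicator {w\<in>space (obs_space S). fst w u} :: _ \<Rightarrow> real)"
          unfolding cylinder_function_def using that
          by (intro exI[of _ "{u}"] exI[of _ "{}"] exI[of _ "\<lambda>x y. of_bool (u \<in> x)"]) (auto simp: indicator_def)
      qed
      show "fst \<circ> (\<lambda>w. w) \<in> space N \<rightarrow> (\<Pi>\<^sub>E i\<in>S. space (count_space UNIV))"
        using sub by (auto simp: N_def space_measure_of obs_space_def space_pair_measure space_PiM)
    qed
    show "snd \<circ> (\<lambda>w. w) \<in> measurable N (PiM E (\<lambda>_. count_space UNIV))"
    proof (rule measurable_PiM_single')
      show "(\<lambda>w. (snd \<circ> (\<lambda>w. w)) w e) \<in> measurable N (count_space UNIV)" if "e \<in> E" for e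
        unfolding comp_def
      proof (rule coordinate)
        show "cylinder_function S (indicator {w\<in>space (obs_space S). snd w e} :: _ \<Rightarrow> real)"
          unfolding cylinder_function_def using that
          by (intro exI[of _ "{}"] exI[of _ "{e}"] exI[of _ "\<lambda>x y. of_bool (e \<in> y)"]) (auto simp: indicator_def)
      qed
      show "snd \<circ> (\<lambda>w. w) \<in> space N \<rightarrow> (\<Pi>\<^sub>E i\<in>E. space (count_space UNIV))"
        using sub by (auto simp: N_def space_measure_of obs_space_def space_pair_measure space_PiM)
    qed
  qed
  then have "A \<in> sets N" if "A \<in> sets (obs_space S)" for A
  proof -
    have "(\<lambda>w. w) -` A \<inter> space N \<in> sets N"
      using \<open>(\<lambda>w. w) \<in> measurable N (obs_space S)\<close> that by (rule measurable_sets)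
    moreover have "(\<lambda>w. w) -` A \<inter> space N = A"
      using sets.sets_into_space[OF that] sub by (auto simp: N_def space_measure_of)
    ultimately show ?thesis by simp
  qed
  then show "sets (obs_space S) \<subseteq> sigma_sets (space (obs_space S)) (cylinder_sets S)"
    using sub by (auto simp: N_def sets_measure_of)
qed

section \<open>From cylinder functions to the conditional mean and the information\<close>

lemma cylinder_function_correlation_bound:
  assumes "v \<in> V" and "S \<subseteq> V" and "cylinder_function S g"
  shows "(expectation (\<lambda>\<omega>. (if X v \<omega> then - 1 else 1) * g (obs S \<omega>)))\<^sup>2
    \<le> perc E (\<theta>\<^sup>2) v S * expectation (\<lambda>\<omega>. (g (obs S \<omega>))\<^sup>2)"
proof -
  obtain S' F h where g: "finite S'" "S' \<subseteq> S" "finite F" "F \<subseteq> E"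
    "\<And>w. w \<in> space (obs_space S) \<Longrightarrow> g w = h {u\<in>S'. fst w u} {e\<in>F. snd w e}"
    using assms(3) unfolding cylinder_function_def by blast
  have eq: "g (obs S \<omega>) = h {u\<in>S'. X u \<omega>} {e\<in>F. Y e \<omega>}" if "\<omega> \<in> space M" for \<omega>
  proof -
    have "{u\<in>S'. fst (obs S \<omega>) u} = {u\<in>S'. X u \<omega>}" "{e\<in>F. snd (obs S \<omega>) e} = {e\<in>F. Y e \<omega>}"
      using g(2,4) by (auto simp: obs_def)
    then show ?thesis using g(5) measurable_space[OF measurable_obs[OF assms(2)] that] by simp
  qed
  show ?thesis
    using cylinder_correlation_bound[OF assms(1) g(1,2) assms(2) g(3,4), of h]
    by (simp add: eq cong: Bochner_Integration.integral_cong)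
qed

text \<open>The correlation bound says that the spin at \<open>v\<close> has norm at most \<open>sqrt perc\<close> as a
  functional on cylinder functions; testing it against cylinder functions approximating the
  conditional mean \<open>m\<close> of the spin bounds the second moment of \<open>m\<close> itself.\<close>
lemma conditional_mean_bound:
  assumes "v \<in> V" and "S \<subseteq> V" and m: "m \<in> borel_measurable (obs_space S)" "\<And>w. \<bar>m w\<bar> \<le> 1"
    and m_cond: "\<And>g. g \<in> borel_measurable (obs_space S) \<Longrightarrow> integrable M (\<lambda>\<omega>. g (obs S \<omega>)) \<Longrightarrow>
        expectation (\<lambda>\<omega>. (if X v \<omega> then - 1 else 1) * g (obs S \<omega>)) = expectation (\<lambda>\<omega>. m (obs S \<omega>) * g (obs S \<omega>))"
  shows "expectation (\<lambda>\<omega>. (m (obs S \<omega>))\<^sup>2) \<le> perc E (\<theta>\<^sup>2) v S"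
proof -
  define N where "N = distr M (obs_space S) (obs S)"
  have obs: "obs S \<in> measurable M (obs_space S)" using assms(2) by (rule measurable_obs)
  interpret N: prob_space N unfolding N_def by (rule prob_space_distr) fact
  have space_N: "space N = space (obs_space S)" and sets_N: "sets N = sets (obs_space S)" by (simp_all add: N_def)
  have borel_N: "borel_measurable N = borel_measurable (obs_space S)"
    by (rule measurable_cong_sets) (simp_all add: sets_N)
  have expectation_N: "expectation (\<lambda>\<omega>. f (obs S \<omega>)) = (\<integral>w. f w \<partial>N)" if "f \<in> borel_measurable (obs_space S)" for f :: "_ \<Rightarrow> real"
    unfolding N_def using obs that by (simp add: integral_distr)
  have bounded_integrable: "integrable N f" if "f \<in> borel_measurable N" "\<And>w. w \<in> space N \<Longrightarrow> \<bar>f w\<bar> \<le> B" for f :: "_ \<Rightarrow> real" and B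
    using that by (intro N.integrable_const_bound[of _ B]) auto
  note m_N = m(1)[folded borel_N]
  let ?p = "perc E (\<theta>\<^sup>2) v S"
  define a where "a = (\<integral>w. (m w)\<^sup>2 \<partial>N)"
  have "0 \<le> ?p" unfolding perc_def by simp
  have "0 \<le> a" by (simp add: a_def)
  \<comment> \<open>A test function \<open>g\<close> within \<open>\<epsilon>\<close> of
    \<open>m\<close> in L1 has correlation at least \<open>a - \<epsilon>\<close> with
    \<open>m\<close> and second moment at most \<open>a + 2 * \<epsilon>\<close>. The claim expands
    the resulting inequality, with the square of \<open>\<epsilon>\<close> dropped.\<close>
  have approx: "a\<^sup>2 \<le> ?p * a + \<epsilon> * (2 * a + 2 * ?p)" if "0 < \<epsilon>" for \<epsilon>
  proof -
    have "\<exists>g. cylinder_function S g \<and> (\<integral>w. \<bar>m w - g w\<bar> \<partial>N) < \<epsilon>"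
    proof (rule N.integrable_approx_by_algebra[of "cylinder_sets S"])
      show "algebra (space N) (cylinder_sets S)" unfolding space_N by (rule algebra_cylinder_sets)
      show "sets N = sigma_sets (space N) (cylinder_sets S)" unfolding space_N sets_N by (rule sets_obs_space)
      show "cylinder_function S (indicator A)" if "A \<in> cylinder_sets S" for A
        using that by (simp add: cylinder_sets_def)
      show "cylinder_function S (\<lambda>x. g x + h x)" if "cylinder_function S g" "cylinder_function S h" for g h
        using that by (rule cylinder_function_combine)
      show "cylinder_function S (\<lambda>x. g x * c)" if "cylinder_function S g" for g c
        using cylinder_function_combine[OF that that, of "\<lambda>a b. a * c"] .
      show "integrable N g" if "cylinder_function S g" for g
        using cylinder_function_bounded[OF that] borel_measurable_cylinder_function[OF that]
        unfolding borel_N[symmetric] space_N[symmetric] using bounded_integrable by blast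
      show "integrable N m" using m_N m(2) by (rule bounded_integrable)
    qed fact
    then obtain g' where g': "cylinder_function S g'" "(\<integral>w. \<bar>m w - g' w\<bar> \<partial>N) < \<epsilon>" by blast
    \<comment> \<open>Truncation to the interval from -1 to 1 preserves cylinder functions and moves
      no point away from \<open>m\<close>, whose values lie there. The bound lets the L1 error
      control the error in the second moment.\<close>
    define g where "g = (\<lambda>w. max (- 1) (min 1 (g' w)))"
    have g: "cylinder_function S g"
      unfolding g_def using cylinder_function_combine[OF g'(1) g'(1), of "\<lambda>a b. max (- 1) (min 1 a)"] .
    note g_meas = borel_measurable_cylinder_function[OF g]
    note g_N [measurable] = g_meas[folded borel_N] and [measurable] = m_N
    have g_bound: "\<bar>g w\<bar> \<le> 1" for w by (auto simp: g_def)
    have g'_int: "integrable N g'"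
      using cylinder_function_bounded[OF g'(1)] borel_measurable_cylinder_function[OF g'(1)]
      unfolding borel_N[symmetric] space_N[symmetric] using bounded_integrable by blast
    have m_int: "integrable N m" using m_N m(2) by (rule bounded_integrable)
    have mult_bound: "\<bar>x * y\<bar> \<le> 1" if "\<bar>x\<bar> \<le> 1" "\<bar>y\<bar> \<le> 1" for x y :: real
      using mult_mono[OF that] by (simp add: abs_mult)
    have int_mg: "integrable N (\<lambda>w. m w * g w)"
      by (rule bounded_integrable[of _ 1]) (auto intro!: mult_bound m g_bound)
    have int_mm: "integrable N (\<lambda>w. (m w)\<^sup>2)"
      by (rule bounded_integrable[of _ 1]) (simp_all add: abs_square_le_1 m(2))
    have int_gg: "integrable N (\<lambda>w. (g w)\<^sup>2)"
      by (rule bounded_integrable[of _ 1]) (simp_all add: abs_square_le_1 g_bound)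
    define d where "d = (\<integral>w. \<bar>m w - g w\<bar> \<partial>N)"
    have g_int: "integrable N g" using g_N g_bound by (rule bounded_integrable)
    have "d \<le> (\<integral>w. \<bar>m w - g' w\<bar> \<partial>N)"
      unfolding d_def
    proof (rule integral_mono)
      show "\<bar>m w - g w\<bar> \<le> \<bar>m w - g' w\<bar>" for w using m(2)[of w] by (auto simp: g_def)
    qed (use m_int g_int g'_int in auto)
    with g'(2) have d: "d < \<epsilon>" by simp
    have "a - (\<integral>w. m w * g w \<partial>N) = (\<integral>w. (m w)\<^sup>2 - m w * g w \<partial>N)"
      unfolding a_def using int_mm int_mg by simp
    also have "\<dots> \<le> d"
      unfolding d_def
    proof (rule integral_mono)
      show "(m w)\<^sup>2 - m w * g w \<le> \<bar>m w - g w\<bar>" for w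
      proof -
        have "(m w)\<^sup>2 - m w * g w \<le> \<bar>m w\<bar> * \<bar>m w - g w\<bar>"
          unfolding abs_mult[symmetric] by (simp add: algebra_simps power2_eq_square)
        also have "\<dots> \<le> 1 * \<bar>m w - g w\<bar>" by (intro mult_right_mono m) simp
        finally show ?thesis by simp
      qed
    qed (use int_mm int_mg m_int g_int in auto)
    finally have mg: "a - \<epsilon> \<le> (\<integral>w. m w * g w \<partial>N)" using d by simp
    have "(\<integral>w. (g w)\<^sup>2 \<partial>N) - a = (\<integral>w. (g w)\<^sup>2 - (m w)\<^sup>2 \<partial>N)"
      unfolding a_def using int_mm int_gg by simp
    also have "\<dots> \<le> (\<integral>w. 2 * \<bar>m w - g w\<bar> \<partial>N)"
    proof (rule integral_mono)
      show "(g w)\<^sup>2 - (m w)\<^sup>2 \<le> 2 * \<bar>m w - g w\<bar>" for w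
      proof -
        have "(g w)\<^sup>2 - (m w)\<^sup>2 \<le> \<bar>g w + m w\<bar> * \<bar>m w - g w\<bar>"
          unfolding abs_mult[symmetric] by (simp add: algebra_simps power2_eq_square)
        also have "\<dots> \<le> 2 * \<bar>m w - g w\<bar>" using m(2)[of w] g_bound[of w] by (intro mult_right_mono) auto
        finally show ?thesis .
      qed
    qed (use int_mm int_gg m_int g_int in auto)
    finally have gg: "(\<integral>w. (g w)\<^sup>2 \<partial>N) \<le> a + 2 * \<epsilon>" using d by (simp add: d_def)
    have "integrable M (\<lambda>\<omega>. g (obs S \<omega>))"
      using g_int unfolding N_def by (rule integrable_distr[OF obs])
    then have "(\<integral>w. m w * g w \<partial>N)\<^sup>2 \<le> ?p * (\<integral>w. (g w)\<^sup>2 \<partial>N)"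
      using cylinder_function_correlation_bound[OF assms(1,2) g] m_cond[OF g_meas]
      using expectation_N[OF borel_measurable_times[OF m(1) g_meas]]
        expectation_N[OF borel_measurable_power[OF g_meas, of 2]] by simp
    also have "\<dots> \<le> ?p * (a + 2 * \<epsilon>)" using gg \<open>0 \<le> ?p\<close> by (rule mult_left_mono)
    finally have sq: "(\<integral>w. m w * g w \<partial>N)\<^sup>2 \<le> ?p * (a + 2 * \<epsilon>)" .
    \<comment> \<open>Squaring the lower bound \<open>a - \<epsilon>\<close> requires it to be
      nonnegative; otherwise the left side here is already at most 0.\<close>
    have "a\<^sup>2 - 2 * a * \<epsilon> \<le> (\<integral>w. m w * g w \<partial>N)\<^sup>2"
    proof (cases "a \<le> \<epsilon>")
      case True
      then have "a * a \<le> a * (2 * \<epsilon>)" using \<open>0 \<le> a\<close> \<open>0 < \<epsilon>\<close> by (intro mult_left_mono) auto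
      then have "a\<^sup>2 - 2 * a * \<epsilon> \<le> 0" by (simp add: power2_eq_square)
      then show ?thesis using zero_le_power2 order_trans by blast
    next
      case False
      have "a\<^sup>2 - 2 * a * \<epsilon> \<le> (a - \<epsilon>)\<^sup>2" by (simp add: power2_diff)
      also have "\<dots> \<le> (\<integral>w. m w * g w \<partial>N)\<^sup>2" using mg False by (intro power_mono) auto
      finally show ?thesis .
    qed
    with sq show ?thesis by (simp add: algebra_simps)
  qed
  have "a\<^sup>2 \<le> ?p * a"
  proof (rule field_le_epsilon)
    fix e :: real assume "0 < e"
    have "0 < 2 * a + 2 * ?p + 1" using \<open>0 \<le> a\<close> \<open>0 \<le> ?p\<close> by simp
    \<comment> \<open>The \<open>+ 1\<close> keeps the denominator positive when \<open>a\<close>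
      and \<open>?p\<close> both vanish.\<close>
    define \<epsilon> where "\<epsilon> = e / (2 * a + 2 * ?p + 1)"
    have "0 < \<epsilon>" using \<open>0 < e\<close> \<open>0 < 2 * a + 2 * ?p + 1\<close> by (simp add: \<epsilon>_def)
    have "\<epsilon> * (2 * a + 2 * ?p) \<le> \<epsilon> * (2 * a + 2 * ?p + 1)" using \<open>0 < \<epsilon>\<close> by simp
    also have "\<dots> = e" using \<open>0 < 2 * a + 2 * ?p + 1\<close> by (simp add: \<epsilon>_def)
    finally show "a\<^sup>2 \<le> ?p * a + e" using approx[OF \<open>0 < \<epsilon>\<close>] by simp
  qed
  then have "a \<le> ?p" using \<open>0 \<le> a\<close> \<open>0 \<le> ?p\<close> by (cases "a = 0") (auto simp: power2_eq_square)
  then show ?thesis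
    using expectation_N[OF borel_measurable_power[OF m(1), of 2]] by (simp add: a_def)
qed

text \<open>The two halves meet in the second moment of the conditional mean, which bounds the
  information and is bounded by the percolation probability.\<close>

lemma mutual_information_le_perc:
  assumes "1 < b" and "v \<in> V" and "S \<subseteq> V"
  shows "mutual_information b (count_space UNIV) (obs_space S) (X v) (obs S)
    \<le> perc E (\<theta>\<^sup>2) v S * log b 2"
proof -
  obtain m where m: "m \<in> borel_measurable (obs_space S)" "\<And>w. \<bar>m w\<bar> \<le> 1"
    "\<And>g. g \<in> borel_measurable (obs_space S) \<Longrightarrow> integrable M (\<lambda>\<omega>. g (obs S \<omega>)) \<Longrightarrow>
        expectation (\<lambda>\<omega>. (if X v \<omega> then - 1 else 1) * g (obs S \<omega>)) = expectation (\<lambda>\<omega>. m (obs S \<omega>) * g (obs S \<omega>))"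
    and I: "mutual_information b (count_space UNIV) (obs_space S) (X v) (obs S)
      \<le> expectation (\<lambda>\<omega>. (m (obs S \<omega>))\<^sup>2) * log b 2"
    using mutual_information_coin_le[OF assms(1) distX measurable_X measurable_obs, OF assms(2,2,3)] by blast
  have "expectation (\<lambda>\<omega>. (m (obs S \<omega>))\<^sup>2) * log b 2 \<le> perc E (\<theta>\<^sup>2) v S * log b 2"
    using conditional_mean_bound[OF assms(2,3) m] \<open>1 < b\<close> by (intro mult_right_mono) auto
  with I show ?thesis by (rule order_trans)
qed

end

theorem theorem1:
  fixes M :: "'a measure" and V :: "'v set" and E :: "'v set set"
    and X :: "'v \<Rightarrow> 'a \<Rightarrow> bool" and Z :: "'v set \<Rightarrow> 'a \<Rightarrow> bool"
    and Y :: "'v set \<Rightarrow> 'a \<Rightarrow> bool"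
    and \<delta> :: real and b :: real and S :: "'v set" and v :: 'v
  assumes "prob_space M"
    and "countable V"
    and "simple_graph V E"
    and "0 \<le> \<delta>" and "\<delta> \<le> 1"
    and "1 < b"
    and indep: "prob_space.indep_vars M (\<lambda>_. count_space UNIV)
          (\<lambda>i. case i of Inl u \<Rightarrow> X u | Inr e \<Rightarrow> Z e) (Inl ` V \<union> Inr ` E)"
    and distX: "\<And>u. u \<in> V \<Longrightarrow> distr M (count_space UNIV) (X u) = measure_pmf (bernoulli_pmf (1/2))"
    and distZ: "\<And>e. e \<in> E \<Longrightarrow> distr M (count_space UNIV) (Z e) = measure_pmf (bernoulli_pmf \<delta>)"
    and Ydef: "\<And>u w \<omega>. {u, w} \<in> E \<Longrightarrow> \<omega> \<in> space M \<Longrightarrow>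
          Y {u, w} \<omega> = ((X u \<omega> \<noteq> X w \<omega>) \<noteq> Z {u, w} \<omega>)"
    and "S \<subseteq> V" and "v \<in> V"
  shows "prob_space.mutual_information M b (count_space UNIV)
           (PiM S (\<lambda>_. count_space UNIV) \<Otimes>\<^sub>M PiM E (\<lambda>_. count_space UNIV))
           (X v) (\<lambda>\<omega>. (restrict (\<lambda>u. X u \<omega>) S, restrict (\<lambda>e. Y e \<omega>) E))
         \<le> perc E ((1 - 2 * \<delta>)\<^sup>2) v S * log b 2"
proof -
  interpret prob_space M by fact
  interpret noisy_parity_observations M V E X Z Y \<delta>
    by standard (fact assms)+
  show ?thesis
    using mutual_information_le_perc[OF \<open>1 < b\<close> \<open>v \<in> V\<close> \<open>S \<subseteq> V\<close>]
    unfolding \<theta>_def obs_space_def obs_def[abs_def] .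
qed

end
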